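(* Let $\mathbb F=\mathbb Z_{\max}$. (i) The epicyclic category $\tilde\Lambda$ is canonically isomorphic to the category $\mathcal P_{\mathbb F}$ whose objects are the semimodules $\mathbb F^{(n)}$, $n\ge 1$, obtained from the one-dimensional free semimodule $\mathbb F$ by restriction of scalars along the endomorphisms $\mathrm{Fr}_n$ of $\mathbb F$, and whose morphisms are the projective classes of semilinear maps $f$ with $f^{-1}(\{0\})=\{0\}$. The object $[n-1]$ of $\tilde\Lambda$ corresponds to $\mathbb F^{(n)}$. (ii) The cyclic category $\Lambda\subset\tilde\Lambda$ is isomorphic to the subcategory $\mathcal P^1_{\mathbb F}\subset\mathcal P_{\mathbb F}$ with the same objects as $\mathcal P_{\mathbb F}$ and whose morphisms are the projective classes induced by linear maps.
   Context: A semifield is a commutative semiring whose non-zero elements form a group under multiplication. $\mathbb F=\mathbb Z_{\max}=(\mathbb Z\cup\{-\infty\},\max,+)$ is written multiplicatively: its elements are $0$ and $u^n$, $n\in\mathbb Z$, with $u^n\vee u^m=u^{\max(n,m)}$ as addition, $0$ neutral for addition, and $u^nu^m=u^{n+m}$. For $n\ge1$, $\mathrm{Fr}_n(x)=x^n$ is an endomorphism of $\mathbb F$. A semimodule over a semifield $K$ is a commutative monoid $(E,+)$ with identity $0$ and a $K$-action with $\lambda(x+y)=\lambda x+\lambda y$, $(\lambda+\mu)x=\lambda x+\mu x$, $(\lambda\mu)x=\lambda(\mu x)$, $0x=0$, $1x=x$. $\mathbb F^{(n)}$ is the semimodule over $\mathbb F$ with the additive structure of $\mathbb F$ and action $\lambda.\xi=\mathrm{Fr}_n(\lambda)\xi$.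 A map $f:E_1\to E_2$ of semimodules over $\mathbb F$ is semilinear if it is additive and there is $\sigma\in\{\mathrm{Fr}_k: k\ge1\}$ with $f(\lambda x)=\sigma(\lambda)f(x)$ for all $\lambda\in\mathbb F$, $x\in E_1$; it is linear if one may take $\sigma=\mathrm{id}$. Two semilinear maps $f,f'$ (with the same $\sigma$) are in the same projective class if $f'=\lambda f$ for some $\lambda\in\mathbb F$, $\lambda\ne0$. Composition of projective classes is induced by composition of maps. The cyclic category $\Lambda$ has objects $[n]$, $n\ge0$, and is the extension of the simplicial category $\Delta$ (objects $[n]=\{0,\dots,n\}$, non-decreasing maps, cofaces $\delta_j$, codegeneracies $\sigma_j$) obtained by adjoining for each $n\ge0$ a generator $\tau_n$ of the cyclic group $\mathrm{Aut}_\Lambda([n])$ of order $n+1$, with relations $\tau_n^{n+1}=\mathrm{id}$, $\tau_n\sigma_0=\sigma_n\tau_{n+1}^2$, $\tau_n\sigma_j=\sigma_{j-1}\tau_{n+1}$ and $\tau_n\delta_j=\delta_{j-1}\tau_{n-1}$ for $1\le j\le n$, and $\tau_n\delta_0=\delta_n$. The epicyclic category $\tilde\Lambda$ is obtained from $\Lambda$ by adjoining morphisms $\pi_n^k:[k(n+1)-1]\to[n]$ ($n\ge0$, $k\ge1$) with relations: $\pi_n^1=\mathrm{id}$ and $\pi_n^\ell\circ\pi_{\ell(n+1)-1}^k=\pi_n^{k\ell}$; $\alpha\,\pi_m^k=\pi_n^k\,\mathrm{Sd}_k(\alpha)$ for $\alpha\in\mathrm{Hom}_\Delta([m],[n])$;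 $\tau_n\pi_n^k=\pi_n^k\tau_{k(n+1)-1}$. Here $\mathrm{Sd}_k:\Delta\to\Delta$ maps $[n-1]$ to $[kn-1]$ and a map $f$ to its $k$-fold concatenation $f\perp\cdots\perp f$. *)

theory Defs
  imports "HOL-Library.FuncSet"
begin

section \<open>Categories, functors, isomorphisms\<close>

record ('o, 'm) cat =
  Obj :: "'o set"
  Arr :: "'m set"
  Src :: "'m \<Rightarrow> 'o"
  Tgt :: "'m \<Rightarrow> 'o"
  Idn :: "'o \<Rightarrow> 'm"
  Cmp :: "'m \<Rightarrow> 'm \<Rightarrow> 'm"  \<comment> \<open>\<open>Cmp C g f\<close> is \<open>g\<close> after \<open>f\<close>\<close>

locale category =
  fixes C :: "('o, 'm) cat"
  assumes Src_in: "f \<in> Arr C \<Longrightarrow> Src C f \<in> Obj C"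
    and Tgt_in: "f \<in> Arr C \<Longrightarrow> Tgt C f \<in> Obj C"
    and Idn_in: "a \<in> Obj C \<Longrightarrow> Idn C a \<in> Arr C"
    and Src_Idn: "a \<in> Obj C \<Longrightarrow> Src C (Idn C a) = a"
    and Tgt_Idn: "a \<in> Obj C \<Longrightarrow> Tgt C (Idn C a) = a"
    and Cmp_in: "\<lbrakk>f \<in> Arr C; g \<in> Arr C; Tgt C f = Src C g\<rbrakk> \<Longrightarrow> Cmp C g f \<in> Arr C"
    and Src_Cmp: "\<lbrakk>f \<in> Arr C; g \<in> Arr C; Tgt C f = Src C g\<rbrakk> \<Longrightarrow> Src C (Cmp C g f) = Src C f"
    and Tgt_Cmp: "\<lbrakk>f \<in> Arr C; g \<in> Arr C; Tgt C f = Src C g\<rbrakk> \<Longrightarrow> Tgt C (Cmp C g f) = Tgt C g"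
    and Cmp_Idn_right: "f \<in> Arr C \<Longrightarrow> Cmp C f (Idn C (Src C f)) = f"
    and Cmp_Idn_left: "f \<in> Arr C \<Longrightarrow> Cmp C (Idn C (Tgt C f)) f = f"
    and Cmp_assoc: "\<lbrakk>f \<in> Arr C; g \<in> Arr C; h \<in> Arr C; Tgt C f = Src C g; Tgt C g = Src C h\<rbrakk>
       \<Longrightarrow> Cmp C h (Cmp C g f) = Cmp C (Cmp C h g) f"

locale cat_functor = C: category C + D: category D
  for C :: "('o, 'm) cat" and D :: "('p, 'n) cat" +
  fixes Fo :: "'o \<Rightarrow> 'p" and Fa :: "'m \<Rightarrow> 'n"
  assumes Fo_in: "a \<in> Obj C \<Longrightarrow> Fo a \<in> Obj D"
    and Fa_in: "f \<in> Arr C \<Longrightarrow> Fa f \<in> Arr D"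
    and Src_Fa: "f \<in> Arr C \<Longrightarrow> Src D (Fa f) = Fo (Src C f)"
    and Tgt_Fa: "f \<in> Arr C \<Longrightarrow> Tgt D (Fa f) = Fo (Tgt C f)"
    and Fa_Idn: "a \<in> Obj C \<Longrightarrow> Fa (Idn C a) = Idn D (Fo a)"
    and Fa_Cmp: "\<lbrakk>f \<in> Arr C; g \<in> Arr C; Tgt C f = Src C g\<rbrakk>
       \<Longrightarrow> Fa (Cmp C g f) = Cmp D (Fa g) (Fa f)"

definition cat_iso ::
    "('o, 'm) cat \<Rightarrow> ('p, 'n) cat \<Rightarrow> ('o \<Rightarrow> 'p) \<Rightarrow> ('m \<Rightarrow> 'n) \<Rightarrow> bool" where
  "cat_iso C D Fo Fa \<longleftrightarrow>
     cat_functor C D Fo Fa \<and> bij_betw Fo (Obj C) (Obj D) \<and> bij_betw Fa (Arr C) (Arr D)"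


section \<open>Adjoining generators subject to relations to a category\<close>

text \<open>
  A path is a word in the arrows of \<open>C\<close> (\<open>Inl\<close>) and the new generators \<open>G\<close> (\<open>Inr\<close>),
  written in the order of composition: \<open>[g, f]\<close> is \<open>g\<close> after \<open>f\<close>, and
  concatenation of words is composition.
\<close>

fun path :: "('o, 'm) cat \<Rightarrow> 'g set \<Rightarrow> ('g \<Rightarrow> 'o) \<Rightarrow> ('g \<Rightarrow> 'o) \<Rightarrow>
    'o \<Rightarrow> 'o \<Rightarrow> ('m + 'g) list \<Rightarrow> bool" where
  "path C G s t a b [] \<longleftrightarrow> a \<in> Obj C \<and> a = b"
| "path C G s t a b (Inl f # w) \<longleftrightarrow> f \<in> Arr C \<and> Tgt C f = b \<and> path C G s t a (Src C f) w"
| "path C G s t a b (Inr g # w) \<longleftrightarrow> g \<in> G \<and> t g = b \<and> b \<in> Obj C \<and> path C G s t a (s g) w"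

text \<open>
  The congruence on paths generated by the composition and identities of \<open>C\<close>
  together with the relations \<open>R\<close>.
\<close>

inductive path_cong :: "('o, 'm) cat \<Rightarrow> 'g set \<Rightarrow> ('g \<Rightarrow> 'o) \<Rightarrow> ('g \<Rightarrow> 'o) \<Rightarrow>
    (('m + 'g) list \<times> ('m + 'g) list) set \<Rightarrow>
    'o \<Rightarrow> 'o \<Rightarrow> ('m + 'g) list \<Rightarrow> ('m + 'g) list \<Rightarrow> bool"
  for C G s t R where
  identity: "a \<in> Obj C \<Longrightarrow> path_cong C G s t R a a [Inl (Idn C a)] []"
| composite: "\<lbrakk>f \<in> Arr C; g \<in> Arr C; Tgt C f = Src C g\<rbrakk> \<Longrightarrow>
    path_cong C G s t R (Src C f) (Tgt C g) [Inl g, Inl f] [Inl (Cmp C g f)]"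
| relation: "\<lbrakk>(v, w) \<in> R; path C G s t a b v; path C G s t a b w\<rbrakk> \<Longrightarrow>
    path_cong C G s t R a b v w"
| refl: "path C G s t a b w \<Longrightarrow> path_cong C G s t R a b w w"
| sym: "path_cong C G s t R a b v w \<Longrightarrow> path_cong C G s t R a b w v"
| trans: "\<lbrakk>path_cong C G s t R a b u v; path_cong C G s t R a b v w\<rbrakk> \<Longrightarrow>
    path_cong C G s t R a b u w"
| append: "\<lbrakk>path_cong C G s t R b c v v'; path_cong C G s t R a b w w'\<rbrakk> \<Longrightarrow>
    path_cong C G s t R a c (v @ w) (v' @ w')"

type_synonym ('o, 'm, 'g) adj_arr = "'o \<times> ('m + 'g) list set \<times> 'o"

definition path_class :: "('o, 'm) cat \<Rightarrow> 'g set \<Rightarrow> ('g \<Rightarrow> 'o) \<Rightarrow> ('g \<Rightarrow> 'o) \<Rightarrow>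
    (('m + 'g) list \<times> ('m + 'g) list) set \<Rightarrow>
    'o \<Rightarrow> 'o \<Rightarrow> ('m + 'g) list \<Rightarrow> ('o, 'm, 'g) adj_arr" where
  "path_class C G s t R a b w = (a, {v. path_cong C G s t R a b w v}, b)"

definition adjoin :: "('o, 'm) cat \<Rightarrow> 'g set \<Rightarrow> ('g \<Rightarrow> 'o) \<Rightarrow> ('g \<Rightarrow> 'o) \<Rightarrow>
    (('m + 'g) list \<times> ('m + 'g) list) set \<Rightarrow> ('o, ('o, 'm, 'g) adj_arr) cat" where
  "adjoin C G s t R = \<lparr>
     Obj = Obj C,
     Arr = {path_class C G s t R a b w | a b w. path C G s t a b w},
     Src = (\<lambda>(a, _, _). a),
     Tgt = (\<lambda>(_, _, b). b),
     Idn = (\<lambda>a. path_class C G s t R a a []),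
     Cmp = (\<lambda>(_, V, c) (a, W, b).
       (a, {x. \<exists>v\<in>V. \<exists>w\<in>W. path_cong C G s t R a c (v @ w) x}, c)) \<rparr>"


section \<open>The simplicial category\<close>

text \<open>
  The object \<open>[n] = {0,\<dots>,n}\<close> is represented by \<open>n\<close>, a map \<open>[m] \<rightarrow> [n]\<close> by \<open>(m, f, n)\<close>
  with \<open>f\<close> extensional on \<open>{..m}\<close>.
\<close>

type_synonym simp_arr = "nat \<times> (nat \<Rightarrow> nat) \<times> nat"

definition Delta :: "(nat, simp_arr) cat" where
  "Delta = \<lparr>
     Obj = UNIV,
     Arr = {(m, f, n) | m f n. f \<in> {..m} \<rightarrow>\<^sub>E {..n} \<and> mono_on {..m} f},
     Src = (\<lambda>(m, _, _). m),
     Tgt = (\<lambda>(_, _, n). n),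
     Idn = (\<lambda>n. (n, \<lambda>i\<in>{..n}. i, n)),
     Cmp = (\<lambda>(_, g, p) (m, f, n). (m, compose {..m} g f, p)) \<rparr>"

text \<open>
  Coface \<open>\<delta>\<^sub>j : [n - 1] \<rightarrow> [n]\<close> (meaningful for \<open>n \<ge> 1\<close>) and codegeneracy
  \<open>\<sigma>\<^sub>j : [n + 1] \<rightarrow> [n]\<close>, both for \<open>0 \<le> j \<le> n\<close>; the first argument is the target \<open>n\<close>.
\<close>

definition coface :: "nat \<Rightarrow> nat \<Rightarrow> simp_arr" where
  "coface n j = (n - 1, \<lambda>i\<in>{..n - 1}. if i < j then i else i + 1, n)"

definition codegen :: "nat \<Rightarrow> nat \<Rightarrow> simp_arr" where
  "codegen n j = (n + 1, \<lambda>i\<in>{..n + 1}. if i \<le> j then i else i - 1, n)"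

text \<open>
  \<open>Sd\<^sub>k\<close>: the \<open>q\<close>-th of the \<open>k\<close> copies of \<open>f : [m] \<rightarrow> [n]\<close> in the concatenation maps
  \<open>q(m + 1) + r\<close> to \<open>q(n + 1) + f(r)\<close>.
\<close>

definition Sd :: "nat \<Rightarrow> simp_arr \<Rightarrow> simp_arr" where
  "Sd k = (\<lambda>(m, f, n).
     (k * (m + 1) - 1,
      \<lambda>i\<in>{..k * (m + 1) - 1}. (i div (m + 1)) * (n + 1) + f (i mod (m + 1)),
      k * (n + 1) - 1))"


section \<open>The cyclic category\<close>

text \<open>The generator \<open>\<tau>\<^sub>n : [n] \<rightarrow> [n]\<close> is the letter \<open>Inr n\<close>.\<close>

definition Lambda_rels :: "((simp_arr + nat) list \<times> (simp_arr + nat) list) set" where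
  "Lambda_rels =
     {(replicate (n + 1) (Inr n), []) | n. True}
   \<union> {([Inr n, Inl (codegen n 0)], [Inl (codegen n n), Inr (n + 1), Inr (n + 1)]) | n. True}
   \<union> {([Inr n, Inl (codegen n j)], [Inl (codegen n (j - 1)), Inr (n + 1)]) | n j.
        1 \<le> j \<and> j \<le> n}
   \<union> {([Inr n, Inl (coface n j)], [Inl (coface n (j - 1)), Inr (n - 1)]) | n j.
        1 \<le> j \<and> j \<le> n}
   \<union> {([Inr n, Inl (coface n 0)], [Inl (coface n n)]) | n. 1 \<le> n}"

type_synonym cyc_arr = "(nat, simp_arr, nat) adj_arr"

definition Lambda :: "(nat, cyc_arr) cat" where
  "Lambda = adjoin Delta UNIV (\<lambda>n. n) (\<lambda>n. n) Lambda_rels"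

definition cyc_class :: "nat \<Rightarrow> nat \<Rightarrow> (simp_arr + nat) list \<Rightarrow> cyc_arr" where
  "cyc_class = path_class Delta UNIV (\<lambda>n. n) (\<lambda>n. n) Lambda_rels"

definition Delta_to_Lambda :: "simp_arr \<Rightarrow> cyc_arr" where
  "Delta_to_Lambda \<alpha> = cyc_class (Src Delta \<alpha>) (Tgt Delta \<alpha>) [Inl \<alpha>]"

definition tau :: "nat \<Rightarrow> cyc_arr" where
  "tau n = cyc_class n n [Inr n]"


section \<open>The epicyclic category\<close>

text \<open>The generator \<open>\<pi>\<^sub>n\<^sup>k : [k(n + 1) - 1] \<rightarrow> [n]\<close>, \<open>k \<ge> 1\<close>, is the letter \<open>Inr (n, k)\<close>.\<close>

definition pi_gens :: "(nat \<times> nat) set" where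
  "pi_gens = {(n, k). 1 \<le> k}"

definition pi_src :: "nat \<times> nat \<Rightarrow> nat" where
  "pi_src = (\<lambda>(n, k). k * (n + 1) - 1)"

definition pi_tgt :: "nat \<times> nat \<Rightarrow> nat" where
  "pi_tgt = (\<lambda>(n, k). n)"

definition Epicyclic_rels ::
    "((cyc_arr + nat \<times> nat) list \<times> (cyc_arr + nat \<times> nat) list) set" where
  "Epicyclic_rels =
     {([Inr (n, 1)], []) | n. True}
   \<union> {([Inr (n, l), Inr (l * (n + 1) - 1, k)], [Inr (n, k * l)]) | n k l. 1 \<le> k \<and> 1 \<le> l}
   \<union> {([Inl (Delta_to_Lambda \<alpha>), Inr (Src Delta \<alpha>, k)],
       [Inr (Tgt Delta \<alpha>, k), Inl (Delta_to_Lambda (Sd k \<alpha>))]) | \<alpha> k. \<alpha> \<in> Arr Delta \<and> 1 \<le> k}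
   \<union> {([Inl (tau n), Inr (n, k)], [Inr (n, k), Inl (tau (k * (n + 1) - 1))]) | n k. 1 \<le> k}"

type_synonym epi_arr = "(nat, cyc_arr, nat \<times> nat) adj_arr"

definition Epicyclic :: "(nat, epi_arr) cat" where
  "Epicyclic = adjoin Lambda pi_gens pi_src pi_tgt Epicyclic_rels"

definition epi_class :: "nat \<Rightarrow> nat \<Rightarrow> (cyc_arr + nat \<times> nat) list \<Rightarrow> epi_arr" where
  "epi_class = path_class Lambda pi_gens pi_src pi_tgt Epicyclic_rels"

definition Lambda_to_Epicyclic :: "cyc_arr \<Rightarrow> epi_arr" where
  "Lambda_to_Epicyclic f = epi_class (Src Lambda f) (Tgt Lambda f) [Inl f]"

definition epi_pi :: "nat \<Rightarrow> nat \<Rightarrow> epi_arr" where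
  "epi_pi n k = epi_class (k * (n + 1) - 1) n [Inr (n, k)]"

text \<open>
  The congruence only uses relations between parallel paths; all the relations above are
  of this kind.
\<close>

lemma coface_in: "1 \<le> n \<Longrightarrow> j \<le> n \<Longrightarrow> coface n j \<in> Arr Delta"
  by (auto simp: coface_def Delta_def mono_on_def)

lemma codegen_in: "j \<le> n \<Longrightarrow> codegen n j \<in> Arr Delta"
  by (auto simp: codegen_def Delta_def mono_on_def)

lemma Lambda_rels_parallel:
  assumes "(v, w) \<in> Lambda_rels"
  shows "\<exists>a b. path Delta UNIV (\<lambda>n. n) (\<lambda>n. n) a b v \<and> path Delta UNIV (\<lambda>n. n) (\<lambda>n. n) a b w"
proof -
  have O: "Obj Delta = UNIV" by (simp add: Delta_def)
  have S: "Src Delta (coface n j) = n - 1" "Tgt Delta (coface n j) = n"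
    "Src Delta (codegen n j) = n + 1" "Tgt Delta (codegen n j) = n" for n j
    by (simp_all add: Delta_def coface_def codegen_def)
  have R: "path Delta UNIV (\<lambda>n. n) (\<lambda>n. n) n n (replicate k (Inr n))" for n k
    by (induction k) (auto simp: O)
  show ?thesis
    using assms R coface_in codegen_in by (fastforce simp: Lambda_rels_def O S)
qed

lemma Sd_in:
  assumes "\<alpha> \<in> Arr Delta" "1 \<le> k"
  shows "Sd k \<alpha> \<in> Arr Delta"
proof -
  obtain m f n where \<alpha>: "\<alpha> = (m, f, n)" by (cases \<alpha>)
  have f: "f i \<le> n" if "i \<le> m" for i using assms(1) that by (auto simp: \<alpha> Delta_def)
  have mono: "f i \<le> f j" if "i \<le> j" "j \<le> m" for i j
    using assms(1) that by (auto simp: \<alpha> Delta_def mono_on_def)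
  define h where "h i = (i div (m + 1)) * (n + 1) + f (i mod (m + 1))" for i
  have m: "i mod (m + 1) \<le> m" for i using mod_less_divisor[of "m + 1" i] by linarith
  have bound: "h i < (i div (m + 1) + 1) * (n + 1)" for i
    using f[OF m[of i]] by (simp add: h_def)
  have h_le: "h i \<le> k * (n + 1) - 1" if "i \<le> k * (m + 1) - 1" for i
  proof -
    have "i < k * (m + 1)" using that assms(2) by (cases k) auto
    then have "i div (m + 1) < k" by (simp add: less_mult_imp_div_less)
    then have "(i div (m + 1) + 1) * (n + 1) \<le> k * (n + 1)" by (intro mult_le_mono1) simp
    then show ?thesis using bound[of i] by linarith
  qed
  have h_mono: "h i \<le> h j" if "i \<le> j" for i j
  proof (cases "i div (m + 1) = j div (m + 1)")
    case True
    then have "i mod (m + 1) \<le> j mod (m + 1)"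
      using that by (metis add_le_cancel_left div_mult_mod_eq)
    then show ?thesis using True mono[OF _ m] by (simp add: h_def)
  next
    case False
    then have "i div (m + 1) + 1 \<le> j div (m + 1)"
      using div_le_mono[OF that, of "m + 1"] by linarith
    then have "(i div (m + 1) + 1) * (n + 1) \<le> (j div (m + 1)) * (n + 1)"
      by (rule mult_le_mono1)
    also have "\<dots> \<le> h j" by (simp add: h_def)
    finally show ?thesis using bound[of i] by linarith
  qed
  have "Sd k \<alpha> = (k * (m + 1) - 1, \<lambda>i\<in>{..k * (m + 1) - 1}. h i, k * (n + 1) - 1)"
    by (simp add: Sd_def \<alpha> h_def)
  then show ?thesis using h_le h_mono by (auto simp: Delta_def mono_on_def simp del: mult_Suc_right)
qed

lemma Epicyclic_rels_parallel:
  assumes "(v, w) \<in> Epicyclic_rels"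
  shows "\<exists>a b. path Lambda pi_gens pi_src pi_tgt a b v \<and> path Lambda pi_gens pi_src pi_tgt a b w"
proof -
  have D: "Delta_to_Lambda \<alpha> \<in> Arr Lambda" "Src Lambda (Delta_to_Lambda \<alpha>) = Src Delta \<alpha>"
    "Tgt Lambda (Delta_to_Lambda \<alpha>) = Tgt Delta \<alpha>" if "\<alpha> \<in> Arr Delta" for \<alpha>
  proof -
    have "path Delta UNIV (\<lambda>n. n) (\<lambda>n. n) (Src Delta \<alpha>) (Tgt Delta \<alpha>) [Inl \<alpha>]"
      using that by (simp add: Delta_def)
    then show "Delta_to_Lambda \<alpha> \<in> Arr Lambda"
      unfolding Delta_to_Lambda_def Lambda_def adjoin_def cyc_class_def by fastforce
  qed (simp_all add: Delta_to_Lambda_def Lambda_def adjoin_def cyc_class_def path_class_def)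
  have T: "tau n \<in> Arr Lambda" "Src Lambda (tau n) = n" "Tgt Lambda (tau n) = n" for n
  proof -
    have "path Delta UNIV (\<lambda>n. n) (\<lambda>n. n) n n [Inr n]"
      by (simp add: Delta_def)
    then show "tau n \<in> Arr Lambda"
      unfolding tau_def Lambda_def adjoin_def cyc_class_def by fastforce
  qed (simp_all add: tau_def Lambda_def adjoin_def cyc_class_def path_class_def)
  have O: "Obj Lambda = UNIV" by (simp add: Lambda_def adjoin_def Delta_def)
  have S: "Src Delta (Sd k \<alpha>) = k * (Src Delta \<alpha> + 1) - 1"
    "Tgt Delta (Sd k \<alpha>) = k * (Tgt Delta \<alpha> + 1) - 1" for k \<alpha>
    by (simp_all add: Delta_def Sd_def split: prod.split)
  have A: "k * (l * (n + 1) - 1 + 1) = k * l * (n + 1)" if "1 \<le> l" for k l n :: nat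
    using that by (cases l) (auto simp: algebra_simps)
  show ?thesis
    using assms unfolding Epicyclic_rels_def
    by (elim UnE; clarsimp simp: O S D T Sd_in pi_gens_def pi_src_def pi_tgt_def
          simp del: mult_Suc_right add_Suc_right)
       (use A in force)+
qed


section \<open>The semifield of tropical integers\<close>

class semifield = comm_semiring_1 +
  assumes nonzero_invertible: "x \<noteq> 0 \<Longrightarrow> \<exists>y. x * y = 1"

text \<open>\<open>U n\<close> is the element \<open>u\<^sup>n\<close>, and \<open>Bot\<close> is \<open>-\<infinity>\<close>, the zero of the semifield.\<close>

datatype zmax = Bot | U int

instantiation zmax :: semifield
begin

definition "0 = Bot"
definition "1 = U 0"

fun plus_zmax :: "zmax \<Rightarrow> zmax \<Rightarrow> zmax" where
  "Bot + y = y"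
| "x + Bot = x"
| "U a + U b = U (max a b)"

fun times_zmax :: "zmax \<Rightarrow> zmax \<Rightarrow> zmax" where
  "Bot * y = Bot"
| "x * Bot = Bot"
| "U a * U b = U (a + b)"

instance
proof
  fix a b c :: zmax
  show "a + b + c = a + (b + c)" by (cases a; cases b; cases c) auto
  show "a + b = b + a" by (cases a; cases b) auto
  show "0 + a = a" by (simp add: zero_zmax_def)
  show "a * b * c = a * (b * c)" by (cases a; cases b; cases c) auto
  show "a * b = b * a" by (cases a; cases b) auto
  show "1 * a = a" by (cases a) (auto simp: one_zmax_def)
  show "0 * a = 0" "a * 0 = 0" by (cases a; simp add: zero_zmax_def)+
  show "(a + b) * c = a * c + b * c" by (cases a; cases b; cases c) auto
  show "(0 :: zmax) \<noteq> 1" by (simp add: zero_zmax_def one_zmax_def)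
  show "\<exists>y. a * y = 1" if "a \<noteq> 0"
  proof (cases a)
    case (U n)
    then have "a * U (- n) = 1" by (simp add: one_zmax_def)
    then show ?thesis ..
  qed (use that in \<open>simp add: zero_zmax_def\<close>)
qed

end

definition Fr :: "nat \<Rightarrow> zmax \<Rightarrow> zmax" where
  "Fr n x = x ^ n"


section \<open>Semimodules and semilinear maps\<close>

text \<open>A semimodule structure on the whole type \<open>'e\<close>.\<close>

record ('k, 'e) semimod =
  add :: "'e \<Rightarrow> 'e \<Rightarrow> 'e"
  zero :: "'e"
  smult :: "'k \<Rightarrow> 'e \<Rightarrow> 'e"

locale semimodule =
  fixes E :: "('k :: semifield, 'e) semimod"
  assumes add_assoc: "add E (add E x y) z = add E x (add E y z)"
    and add_commute: "add E x y = add E y x"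
    and add_zero: "add E (zero E) x = x"
    and smult_add_right: "smult E a (add E x y) = add E (smult E a x) (smult E a y)"
    and smult_add_left: "smult E (a + b) x = add E (smult E a x) (smult E b x)"
    and smult_mult: "smult E (a * b) x = smult E a (smult E b x)"
    and smult_0: "smult E 0 x = zero E"
    and smult_1: "smult E 1 x = x"

definition free1 :: "('k :: semifield, 'k) semimod" where
  "free1 = \<lparr> add = (+), zero = 0, smult = (*) \<rparr>"

definition restrict_scalars :: "('k \<Rightarrow> 'k) \<Rightarrow> ('k, 'e) semimod \<Rightarrow> ('k, 'e) semimod" where
  "restrict_scalars \<phi> E = E \<lparr> smult := (\<lambda>a. smult E (\<phi> a)) \<rparr>"

text \<open>The semimodule \<open>\<bbbF>\<^bsup>(n)\<^esup>\<close>.\<close>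

definition F_Fr :: "nat \<Rightarrow> (zmax, zmax) semimod" where
  "F_Fr n = restrict_scalars (Fr n) free1"

lemma Fr_add: "Fr n (x + y) = Fr n x + Fr n y"
proof -
  have U: "Fr m (U a) = U (int m * a)" for m a
    by (induction m) (simp_all add: Fr_def one_zmax_def algebra_simps)
  show ?thesis
  proof (cases "n = 0")
    case True
    then show ?thesis by (simp add: Fr_def one_zmax_def)
  next
    case False
    then have B: "Fr n Bot = Bot" by (cases n) (simp_all add: Fr_def)
    show ?thesis by (cases x; cases y) (auto simp: U B max_def mult_le_cancel_left)
  qed
qed

lemma semimodule_F_Fr: "1 \<le> n \<Longrightarrow> semimodule (F_Fr n)"
  by unfold_locales
    (simp_all add: F_Fr_def restrict_scalars_def free1_def algebra_simps Fr_add[unfolded Fr_def]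
      Fr_def power_mult_distrib zero_power)

definition semilinear_wrt ::
    "(zmax \<Rightarrow> zmax) \<Rightarrow> (zmax, 'e) semimod \<Rightarrow> (zmax, 'f) semimod \<Rightarrow> ('e \<Rightarrow> 'f) \<Rightarrow> bool" where
  "semilinear_wrt \<sigma> E1 E2 f \<longleftrightarrow>
     (\<forall>x y. f (add E1 x y) = add E2 (f x) (f y)) \<and>
     (\<forall>a x. f (smult E1 a x) = smult E2 (\<sigma> a) (f x))"

definition semilinear :: "(zmax, 'e) semimod \<Rightarrow> (zmax, 'f) semimod \<Rightarrow> ('e \<Rightarrow> 'f) \<Rightarrow> bool" where
  "semilinear E1 E2 f \<longleftrightarrow> (\<exists>k\<ge>1. semilinear_wrt (Fr k) E1 E2 f)"

definition linear :: "(zmax, 'e) semimod \<Rightarrow> (zmax, 'f) semimod \<Rightarrow> ('e \<Rightarrow> 'f) \<Rightarrow> bool" where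
  "linear E1 E2 f \<longleftrightarrow> semilinear_wrt id E1 E2 f"

definition proj_eq ::
    "(zmax, 'e) semimod \<Rightarrow> (zmax, 'f) semimod \<Rightarrow> ('e \<Rightarrow> 'f) \<Rightarrow> ('e \<Rightarrow> 'f) \<Rightarrow> bool" where
  "proj_eq E1 E2 f f' \<longleftrightarrow>
     (\<exists>k\<ge>1. semilinear_wrt (Fr k) E1 E2 f \<and> semilinear_wrt (Fr k) E1 E2 f') \<and>
     (\<exists>a. a \<noteq> 0 \<and> f' = (\<lambda>x. smult E2 a (f x)))"

type_synonym 'e proj_arr = "(zmax, 'e) semimod \<times> ('e \<Rightarrow> 'e) set \<times> (zmax, 'e) semimod"

definition proj_class ::
    "(zmax, 'e) semimod \<Rightarrow> (zmax, 'e) semimod \<Rightarrow> ('e \<Rightarrow> 'e) \<Rightarrow> 'e proj_arr" where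
  "proj_class E1 E2 f = (E1, {f'. proj_eq E1 E2 f f'}, E2)"


section \<open>The projective categories\<close>

definition PF :: "((zmax, zmax) semimod, zmax proj_arr) cat" where
  "PF = \<lparr>
     Obj = {F_Fr n | n. 1 \<le> n},
     Arr = {proj_class (F_Fr m) (F_Fr n) f | m n f. 1 \<le> m \<and> 1 \<le> n \<and>
       semilinear (F_Fr m) (F_Fr n) f \<and> f -` {zero (F_Fr n)} = {zero (F_Fr m)}},
     Src = (\<lambda>(E, _, _). E),
     Tgt = (\<lambda>(_, _, E). E),
     Idn = (\<lambda>E. proj_class E E id),
     Cmp = (\<lambda>(_, Q, E3) (E1, P, _). (E1, {g \<circ> f | f g. f \<in> P \<and> g \<in> Q}, E3)) \<rparr>"

definition PF1 :: "((zmax, zmax) semimod, zmax proj_arr) cat" where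
  "PF1 = PF \<lparr> Arr := {(E1, P, E2) | E1 P E2. (E1, P, E2) \<in> Arr PF \<and> (\<exists>f\<in>P. linear E1 E2 f)} \<rparr>"

text \<open>
  The map \<open>\<bbbF>\<^bsup>(m + 1)\<^esup> \<rightarrow> \<bbbF>\<^bsup>(n + 1)\<^esup>\<close> attached to \<open>\<alpha> : [m] \<rightarrow> [n]\<close> in the simplicial category
  is the unique linear map sending \<open>u\<^sup>i\<close> to \<open>u\<close> to the power \<open>\<alpha>(i)\<close> for \<open>0 \<le> i \<le> m\<close>.
\<close>

fun simp_map :: "simp_arr \<Rightarrow> zmax \<Rightarrow> zmax" where
  "simp_map (m, f, n) Bot = Bot"
| "simp_map (m, f, n) (U x) =
     U ((x div (int m + 1)) * (int n + 1) + int (f (nat (x mod (int m + 1)))))"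

text \<open>
  The values on the generators of the epicyclic category that make the isomorphism canonical:
  \<open>\<tau>\<^sub>n\<close> acts as division by \<open>u\<close> (forced by \<open>\<tau>\<^sub>n \<delta>\<^sub>0 = \<delta>\<^sub>n\<close>), and \<open>\<pi>\<^sub>n\<^sup>k\<close> as the identity map,
  regarded as a map \<open>\<bbbF>\<^bsup>(k(n + 1))\<^esup> \<rightarrow> \<bbbF>\<^bsup>(n + 1)\<^esup>\<close> semilinear with respect to \<open>Fr k\<close>.
\<close>

definition canonical_on_generators :: "(epi_arr \<Rightarrow> zmax proj_arr) \<Rightarrow> bool" where
  "canonical_on_generators \<Phi> \<longleftrightarrow>
     (\<forall>\<alpha>\<in>Arr Delta. \<Phi> (Lambda_to_Epicyclic (Delta_to_Lambda \<alpha>)) =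
        proj_class (F_Fr (Src Delta \<alpha> + 1)) (F_Fr (Tgt Delta \<alpha> + 1)) (simp_map \<alpha>)) \<and>
     (\<forall>n. \<Phi> (Lambda_to_Epicyclic (tau n)) =
        proj_class (F_Fr (n + 1)) (F_Fr (n + 1)) (\<lambda>x. U (- 1) * x)) \<and>
     (\<forall>n k. 1 \<le> k \<longrightarrow> \<Phi> (epi_pi n k) = proj_class (F_Fr (k * (n + 1))) (F_Fr (n + 1)) id)"

end

theory Submission
  imports Defs
begin

text \<open>
  A semilinear map \<open>\<bbbF>\<^bsup>(m)\<^esup> \<rightarrow> \<bbbF>\<^bsup>(n)\<^esup>\<close> with trivial kernel is the same as a monotone map
  \<open>g : \<int> \<rightarrow> \<int>\<close> with \<open>g(x + m) = g(x) + kn\<close>, and projective classes identify \<open>g\<close> with its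
  translates by multiples of \<open>n\<close>.

  In degree \<open>k = 1\<close>, such a \<open>g\<close> factors uniquely as a simplicial map \<open>\<alpha>\<close> after a translation: the
  translation is determined by the least \<open>x\<close> with \<open>g(x) \<ge> 0\<close>. On the side of generators and relations,
  the relations of \<open>\<Lambda>\<close> move every \<open>\<tau>\<close> to the right of all simplicial maps, because they do so for
  cofaces and codegeneracies, which generate \<open>\<Delta>\<close>. So every word is equivalent to a normal form
  \<open>\<alpha> \<tau>\<^sup>j\<close>, and comparing the two gives part (ii).

  In degree \<open>k\<close>, a map into \<open>\<bbbF>\<^bsup>(n)\<^esup>\<close> is a degree-one map into \<open>\<bbbF>\<^bsup>(kn)\<^esup>\<close>, and correspondingly every
  word of the epicyclic category is equivalent to \<open>\<pi>\<^sup>k f\<close> with \<open>f\<close> in \<open>\<Lambda>\<close>. Two such \<open>f\<close> give the same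
  projective class exactly if they differ by a translation by a multiple of \<open>n\<close>, and \<open>\<pi>\<^sup>k\<close> absorbs
  these translations.
\<close>

section \<open>Words in adjoined generators\<close>

locale adjoining = C: category C for C :: "('o, 'm) cat" +
  fixes G :: "'g set" and s t :: "'g \<Rightarrow> 'o" and R :: "(('m + 'g) list \<times> ('m + 'g) list) set"
begin

abbreviation pth where "pth \<equiv> path C G s t"
abbreviation cong where "cong \<equiv> path_cong C G s t R"
abbreviation cls where "cls \<equiv> path_class C G s t R"
abbreviation adj where "adj \<equiv> adjoin C G s t R"

lemma path_Obj: "pth a b w \<Longrightarrow> a \<in> Obj C \<and> b \<in> Obj C"
proof (induction w arbitrary: b)
  case (Cons x w)
  then show ?case by (cases x) (auto simp: C.Tgt_in)
qed auto

lemma path_append: "pth a c (v @ w) \<longleftrightarrow> (\<exists>b. pth b c v \<and> pth a b w)"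
proof (induction v arbitrary: c)
  case Nil
  then show ?case using path_Obj by auto
next
  case (Cons x v)
  then show ?case by (cases x) auto
qed

lemma path_appendI: "pth b c v \<Longrightarrow> pth a b w \<Longrightarrow> pth a c (v @ w)"
  using path_append by blast

lemma cong_path: "cong a b v w \<Longrightarrow> pth a b v \<and> pth a b w"
  by (induction rule: path_cong.induct)
    (auto simp: C.Idn_in C.Src_Idn C.Tgt_Idn C.Src_in C.Tgt_in C.Cmp_in C.Src_Cmp C.Tgt_Cmp intro: path_appendI)

lemmas cong_refl = path_cong.refl[of C G s t _ _ _ R]
lemmas cong_sym = path_cong.sym[of C G s t R]
lemmas cong_trans[trans] = path_cong.trans[of C G s t R]
lemmas cong_append = path_cong.append[of C G s t R]

lemma cong_appendL: "pth b c u \<Longrightarrow> cong a b v w \<Longrightarrow> cong a c (u @ v) (u @ w)"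
  by (intro cong_append cong_refl)

lemma cong_appendR: "cong b c v w \<Longrightarrow> pth a b u \<Longrightarrow> cong a c (v @ u) (w @ u)"
  by (intro cong_append cong_refl)

lemma cls_eqI: "cong a b v w \<Longrightarrow> cls a b v = cls a b w"
  unfolding path_class_def using cong_trans cong_sym by blast

lemma cls_in: "pth a b w \<Longrightarrow> cls a b w \<in> Arr adj"
  by (auto simp: adjoin_def)

lemma Arr_adjE:
  assumes "f \<in> Arr adj"
  obtains a b w where "pth a b w" "f = cls a b w"
  using assms by (auto simp: adjoin_def)

lemma Src_cls [simp]: "Src adj (cls a b w) = a"
  and Tgt_cls [simp]: "Tgt adj (cls a b w) = b"
  and Obj_adj [simp]: "Obj adj = Obj C"
  and Idn_adj: "Idn adj a = cls a a []"
  by (simp_all add: adjoin_def path_class_def)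

text \<open>The composite in \<open>adjoin\<close> collects all words congruent to a concatenation
  of representatives. Since congruence is transitive and compatible with concatenation, this is one
  class, and any single pair of representatives computes it.\<close>

lemma Cmp_cls:
  assumes "pth b c v" "pth a b w"
  shows "Cmp adj (cls b c v) (cls a b w) = cls a c (v @ w)"
proof -
  have "(\<exists>v'. cong b c v v' \<and> (\<exists>w'. cong a b w w' \<and> cong a c (v' @ w') x)) \<longleftrightarrow> cong a c (v @ w) x" for x
  proof
    assume "cong a c (v @ w) x"
    then show "\<exists>v'. cong b c v v' \<and> (\<exists>w'. cong a b w w' \<and> cong a c (v' @ w') x)"
      using assms cong_refl by blast
  qed (blast intro: cong_append cong_trans)
  then show ?thesis by (simp add: adjoin_def path_class_def)
qed

lemma category_adj: "category adj"
proof
  show "Cmp adj f (Idn adj (Src adj f)) = f" if "f \<in> Arr adj" for f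
    using that by (elim Arr_adjE) (use path_Obj in \<open>fastforce simp: Idn_adj Cmp_cls\<close>)
  show "Cmp adj (Idn adj (Tgt adj f)) f = f" if "f \<in> Arr adj" for f
    using that by (elim Arr_adjE) (use path_Obj in \<open>fastforce simp: Idn_adj Cmp_cls\<close>)
qed (auto elim!: Arr_adjE simp: Idn_adj Cmp_cls path_appendI dest: path_Obj intro!: cls_in)

lemma cong_Idn: "a \<in> Obj C \<Longrightarrow> cong a a [Inl (Idn C a)] []"
  by (rule path_cong.identity)

lemma cong_Cmp: "f \<in> Arr C \<Longrightarrow> g \<in> Arr C \<Longrightarrow> Tgt C f = Src C g \<Longrightarrow> a = Src C f \<Longrightarrow> b = Tgt C g
    \<Longrightarrow> cong a b [Inl g, Inl f] [Inl (Cmp C g f)]"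
  by (simp add: path_cong.composite)

lemma cong_rel: "(v, w) \<in> R \<Longrightarrow> pth a b v \<Longrightarrow> pth a b w \<Longrightarrow> cong a b v w"
  by (rule path_cong.relation)

end

section \<open>Evaluation of words in a target category\<close>

fun eval_path :: "('p, 'n) cat \<Rightarrow> ('o \<Rightarrow> 'p) \<Rightarrow> ('m \<Rightarrow> 'n) \<Rightarrow> ('g \<Rightarrow> 'n) \<Rightarrow> 'o \<Rightarrow> ('m + 'g) list \<Rightarrow> 'n" where
  "eval_path D Fo Fa Fg a [] = Idn D (Fo a)"
| "eval_path D Fo Fa Fg a (Inl f # w) = Cmp D (Fa f) (eval_path D Fo Fa Fg a w)"
| "eval_path D Fo Fa Fg a (Inr g # w) = Cmp D (Fg g) (eval_path D Fo Fa Fg a w)"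

text \<open>A representative is chosen arbitrarily; \<open>ext_cls\<close> shows that the choice
  does not affect the value.\<close>

definition adjoin_extend :: "('p, 'n) cat \<Rightarrow> ('o \<Rightarrow> 'p) \<Rightarrow> ('m \<Rightarrow> 'n) \<Rightarrow> ('g \<Rightarrow> 'n) \<Rightarrow>
    ('o, 'm, 'g) adj_arr \<Rightarrow> 'n" where
  "adjoin_extend D Fo Fa Fg = (\<lambda>(a, W, b). eval_path D Fo Fa Fg a (SOME w. w \<in> W))"

text \<open>The data for the universal property of adjoining generators: a functor on
  \<open>C\<close> and images of the new generators that satisfy the relations. It yields the
  functor \<open>ext\<close> on \<open>adj\<close>.\<close>

locale adjoining_functor = adjoining C G s t R + cat_functor C D Fo Fa
  for C :: "('o, 'm) cat" and G :: "'g set" and s t and R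
    and D :: "('p, 'n) cat" and Fo and Fa +
  fixes Fg :: "'g \<Rightarrow> 'n"
  assumes Fg_in: "g \<in> G \<Longrightarrow> Fg g \<in> Arr D"
    and Src_Fg: "g \<in> G \<Longrightarrow> Src D (Fg g) = Fo (s g)"
    and Tgt_Fg: "g \<in> G \<Longrightarrow> Tgt D (Fg g) = Fo (t g)"
    and rel_Fg: "\<lbrakk>(v, w) \<in> R; path C G s t a b v; path C G s t a b w\<rbrakk> \<Longrightarrow>
      eval_path D Fo Fa Fg a v = eval_path D Fo Fa Fg a w"
begin

abbreviation ev where "ev \<equiv> eval_path D Fo Fa Fg"

lemma ev_in: "pth a b w \<Longrightarrow> ev a w \<in> Arr D \<and> Src D (ev a w) = Fo a \<and> Tgt D (ev a w) = Fo b"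
proof (induction w arbitrary: b)
  case Nil
  then show ?case by (auto simp: D.Idn_in D.Src_Idn D.Tgt_Idn Fo_in)
next
  case (Cons x w)
  then show ?case
    by (cases x) (auto simp: Fa_in Src_Fa Tgt_Fa Fg_in Src_Fg Tgt_Fg D.Cmp_in D.Src_Cmp D.Tgt_Cmp)
qed

lemma ev_append: "pth b c v \<Longrightarrow> pth a b w \<Longrightarrow> ev a (v @ w) = Cmp D (ev b v) (ev a w)"
proof (induction v arbitrary: c)
  case Nil
  then show ?case using ev_in[of a b w] D.Cmp_Idn_left by fastforce
next
  case (Cons x v)
  note [simp] = Fa_in Src_Fa Tgt_Fa Fg_in Src_Fg Tgt_Fg
  show ?case
  proof (cases x)
    case (Inl f)
    then show ?thesis
      using Cons.prems Cons.IH[of "Src C f"] ev_in[of a b w] ev_in[of b "Src C f" v] by (auto simp: D.Cmp_assoc)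
  next
    case (Inr g)
    then show ?thesis
      using Cons.prems Cons.IH[of "s g"] ev_in[of a b w] ev_in[of b "s g" v] by (auto simp: D.Cmp_assoc)
  qed
qed

lemma ev_single:
  "f \<in> Arr C \<Longrightarrow> ev (Src C f) [Inl f] = Fa f"
  "g \<in> G \<Longrightarrow> s g \<in> Obj C \<Longrightarrow> ev (s g) [Inr g] = Fg g"
  using D.Cmp_Idn_right[of "Fa f"] D.Cmp_Idn_right[of "Fg g"]
  by (simp_all add: Fa_in Src_Fa Fg_in Src_Fg)

text \<open>Every clause generating the congruence is respected: identities and composites by
  functoriality of \<open>Fa\<close>, the listed relations by \<open>rel_Fg\<close>, and
  concatenation by \<open>ev_append\<close>, whose typing premises come from
  \<open>cong_path\<close>.\<close>

lemma ev_cong: "cong a b v w \<Longrightarrow> ev a v = ev a w"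
proof (induction rule: path_cong.induct)
  case (identity a)
  then show ?case
    using D.Cmp_Idn_right[of "Idn D (Fo a)"] by (simp add: Fa_Idn Fo_in D.Idn_in D.Src_Idn)
next
  case (composite f g)
  have "ev (Src C f) [Inl g, Inl f] = Cmp D (Fa g) (Fa f)"
    using ev_single(1)[OF composite(1)] by simp
  also have "\<dots> = ev (Src C f) [Inl (Cmp C g f)]"
    using composite ev_single(1)[of "Cmp C g f"]
    by (simp add: Fa_Cmp C.Cmp_in C.Src_Cmp del: eval_path.simps)
  finally show ?case .
next
  case (append b c v v' a w w')
  then show ?case
    using ev_append cong_path by metis
qed (auto intro: rel_Fg)

abbreviation ext where "ext \<equiv> adjoin_extend D Fo Fa Fg"

lemma ext_cls: "pth a b w \<Longrightarrow> ext (cls a b w) = ev a w"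
  unfolding adjoin_extend_def path_class_def
  by (simp, rule someI2[of _ w]) (auto intro: cong_refl simp: ev_cong)

lemma functor_ext: "cat_functor adj D Fo ext"
proof -
  interpret adj: category adj by (rule category_adj)
  show ?thesis
  proof
    fix f g assume "f \<in> Arr adj" "g \<in> Arr adj" "Tgt adj f = Src adj g"
    then show "ext (Cmp adj g f) = Cmp D (ext g) (ext f)"
      by (auto elim!: Arr_adjE simp: Cmp_cls ext_cls path_appendI ev_append)
  qed (auto elim!: Arr_adjE simp: ext_cls ev_in Fo_in Idn_adj)
qed

lemma ext_Inl: "f \<in> Arr C \<Longrightarrow> ext (cls (Src C f) (Tgt C f) [Inl f]) = Fa f"
  by (subst ext_cls) (auto simp: C.Src_in ev_single simp del: eval_path.simps)

lemma ext_Inr: "g \<in> G \<Longrightarrow> s g \<in> Obj C \<Longrightarrow> t g \<in> Obj C \<Longrightarrow> ext (cls (s g) (t g) [Inr g]) = Fg g"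
  by (subst ext_cls) (auto simp: ev_single simp del: eval_path.simps)

end

section \<open>Semilinear maps as maps of the integers\<close>

definition zext :: "(int \<Rightarrow> int) \<Rightarrow> zmax \<Rightarrow> zmax" where
  "zext g x = (case x of Bot \<Rightarrow> Bot | U i \<Rightarrow> U (g i))"

lemma zext_simps [simp]: "zext g Bot = Bot" "zext g (U i) = U (g i)"
  by (simp_all add: zext_def)

lemma zext_eq_iff [simp]: "zext g = zext h \<longleftrightarrow> g = h"
  by (metis zext_simps(2) ext zmax.inject)

lemma zext_comp: "zext g \<circ> zext h = zext (g \<circ> h)"
  by (auto simp: fun_eq_iff zext_def split: zmax.splits)

lemma zext_id: "zext id = id" "zext (\<lambda>x. x) = id"
  by (auto simp: fun_eq_iff zext_def split: zmax.splits)

lemma zext_translate: "(\<lambda>x. U c * x) = zext (\<lambda>x. x + c)"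
  by (auto simp: fun_eq_iff zext_def split: zmax.splits)

lemma Fr_U [simp]: "Fr n (U a) = U (int n * a)"
  by (induction n) (simp_all add: Fr_def one_zmax_def algebra_simps)

lemma Fr_Bot: "1 \<le> n \<Longrightarrow> Fr n Bot = Bot"
  by (cases n) (simp_all add: Fr_def)

lemma F_Fr_sel [simp]:
  "add (F_Fr n) x y = x + y" "zero (F_Fr n) = Bot" "smult (F_Fr n) a x = Fr n a * x"
  by (simp_all add: F_Fr_def restrict_scalars_def free1_def zero_zmax_def)

lemma F_Fr_inj [simp]: "F_Fr m = F_Fr n \<longleftrightarrow> m = n"
proof
  assume "F_Fr m = F_Fr n"
  then have "smult (F_Fr m) (U 1) (U 0) = smult (F_Fr n) (U 1) (U 0)" by simp
  then show "m = n" by simp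
qed simp

text \<open>Monotonicity is additivity, because addition in \<int>_max is the maximum. The
  periodicity is equivariance for \<open>U 1\<close>, which translates by \<open>m\<close> on the
  source and, after \<open>Fr k\<close>, by \<open>k * n\<close> on the target.\<close>

definition degree_map :: "nat \<Rightarrow> nat \<Rightarrow> nat \<Rightarrow> (int \<Rightarrow> int) \<Rightarrow> bool" where
  "degree_map k m n g \<longleftrightarrow> mono g \<and> (\<forall>x. g (x + int m) = g x + int k * int n)"

lemma degree_map_mult:
  assumes "degree_map k m n g"
  shows "g (x + int m * i) = g x + int k * int n * i"
proof -
  have *: "g (y + int m * int j) = g y + int k * int n * int j" for y j
  proof (induction j)
    case (Suc j)
    have "g (y + int m * int (Suc j)) = g (y + int m * int j + int m)"
      by (simp add: algebra_simps)
    also have "\<dots> = g (y + int m * int j) + int k * int n"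
      using assms by (simp add: degree_map_def)
    finally show ?case using Suc by (simp add: algebra_simps)
  qed simp
  show ?thesis
  proof (cases "0 \<le> i")
    case True
    then show ?thesis using *[of x "nat i"] by simp
  next
    case False
    \<comment> \<open>Moving forward by \<open>- i\<close> periods from the shifted point leads back
      to \<open>x\<close>.\<close>
    then show ?thesis using *[of "x + int m * i" "nat (- i)"] by (simp add: algebra_simps)
  qed
qed

text \<open>Periodicity recovers the whole map from a fundamental domain, so identities between
  integer maps become checks at finitely many arguments.\<close>

lemma degree_map_eqI:
  assumes "degree_map k m n g" "degree_map k m n h" "1 \<le> m"
    and "\<And>i. i < m \<Longrightarrow> g (int i) = h (int i)"
  shows "g = h"
proof
  fix x
  define r where "r = nat (x mod int m)"
  have x: "int r + int m * (x div int m) = x" and "r < m"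
    using assms(3) by (auto simp: r_def nat_less_iff)
  then show "g x = h x"
    using assms(4)[of r] degree_map_mult[OF assms(1), of "int r" "x div int m"]
      degree_map_mult[OF assms(2), of "int r" "x div int m"]
    by simp
qed

lemma degree_map_comp:
  assumes "degree_map k m n g" "degree_map l n p h"
  shows "degree_map (k * l) m p (h \<circ> g)"
  unfolding degree_map_def
proof (intro conjI allI)
  show "mono (h \<circ> g)" using assms by (auto simp: degree_map_def mono_def)
  fix x
  have "g (x + int m) = g x + int n * int k"
    using assms(1) by (simp add: degree_map_def)
  then show "(h \<circ> g) (x + int m) = (h \<circ> g) x + int (k * l) * int p"
    using degree_map_mult[OF assms(2)] by simp
qed

lemma degree_map_add: "degree_map k m n g \<Longrightarrow> degree_map k m n (\<lambda>x. g x + c)"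
  by (auto simp: degree_map_def mono_def)

lemma degree_map_translate: "degree_map 1 n n (\<lambda>x. x + c)"
  by (auto simp: degree_map_def mono_def)

lemma degree_map_unique:
  assumes "degree_map k m n g" "degree_map l m n g" "1 \<le> n"
  shows "k = l"
  using assms by (auto simp: degree_map_def)

text \<open>Equivariance is read off at the scalar \<open>U 1\<close> alone; conversely
  \<open>degree_map_mult\<close> gives it for all powers of u, and the scalar \<open>Bot\<close> is
  harmless because positive powers fix it.\<close>

lemma semilinear_wrt_zext:
  assumes "1 \<le> m" "1 \<le> n" "1 \<le> k"
  shows "semilinear_wrt (Fr k) (F_Fr m) (F_Fr n) (zext g) \<longleftrightarrow> degree_map k m n g"
proof
  assume *: "semilinear_wrt (Fr k) (F_Fr m) (F_Fr n) (zext g)"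
  have "zext g (U x + U y) = zext g (U x) + zext g (U y)" for x y
    using * unfolding semilinear_wrt_def F_Fr_sel by blast
  then have "max (g x) (g y) = g (max x y)" for x y by simp
  then have "mono g" by (metis max.absorb_iff2 monoI)
  moreover have "zext g (Fr m (U 1) * U x) = Fr n (Fr k (U 1)) * zext g (U x)" for x
    using * by (simp add: semilinear_wrt_def del: Fr_U)
  ultimately show "degree_map k m n g" by (auto simp: degree_map_def algebra_simps)
next
  assume *: "degree_map k m n g"
  have "zext g (x + y) = zext g x + zext g y" for x y
    using * by (cases x; cases y) (auto simp: degree_map_def max_of_mono)
  moreover have "zext g (Fr m a * x) = Fr n (Fr k a) * zext g x" for a x
    using assms degree_map_mult[OF *] 
    by (cases a; cases x) (auto simp: Fr_Bot algebra_simps)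
  ultimately show "semilinear_wrt (Fr k) (F_Fr m) (F_Fr n) (zext g)"
    by (simp add: semilinear_wrt_def)
qed

lemma kernel_zext: "zext g -` {Bot} = {Bot}"
  by (auto simp: zext_def split: zmax.splits)

text \<open>A trivial kernel means that \<open>Bot\<close> goes to \<open>Bot\<close> and nothing
  else does, so the map restricts to the exponents of the nonzero elements.\<close>

lemma semilinear_zextE:
  assumes "semilinear (F_Fr m) (F_Fr n) f" "f -` {Bot} = {Bot}" "1 \<le> m" "1 \<le> n"
  obtains k g where "1 \<le> k" "degree_map k m n g" "f = zext g"
proof -
  have B: "f x = Bot \<longleftrightarrow> x = Bot" for x using assms(2) by blast
  define g where "g i = (THE j. f (U i) = U j)" for i
  have "f (U i) = U (g i)" for i
    using B[of "U i"] by (cases "f (U i)") (auto simp: g_def)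
  then have f: "f = zext g"
    using B by (auto simp: fun_eq_iff zext_def split: zmax.splits)
  then show ?thesis
    using assms that semilinear_wrt_zext by (auto simp: semilinear_def)
qed

text \<open>The class of \<open>g\<close> modulo multiples of \<open>n\<close>: this is how \<open>\<bbbF>\<close> acts on maps into \<open>\<bbbF>\<^bsup>(n)\<^esup>\<close>.\<close>

definition parr :: "nat \<Rightarrow> nat \<Rightarrow> (int \<Rightarrow> int) \<Rightarrow> zmax proj_arr" where
  "parr m n g = proj_class (F_Fr m) (F_Fr n) (zext g)"

text \<open>The scalar \<open>U c\<close> acts on \<open>F_Fr n\<close> through \<open>Fr n\<close>,
  hence translates by \<open>n * c\<close>. Adding a constant preserves the degree, so the same
  \<open>k\<close> witnesses semilinearity for every translate.\<close>

lemma parr_eq: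
  assumes "degree_map k m n g" "1 \<le> m" "1 \<le> n" "1 \<le> k"
  shows "parr m n g = (F_Fr m, {zext (\<lambda>x. g x + int n * c) | c. True}, F_Fr n)"
proof -
  have S: "semilinear_wrt (Fr k) (F_Fr m) (F_Fr n) (zext (\<lambda>x. g x + c))" for c
    using assms degree_map_add semilinear_wrt_zext by blast
  have M: "(\<lambda>x. smult (F_Fr n) (U c) (zext g x)) = zext (\<lambda>x. g x + int n * c)" for c
    by (auto simp: fun_eq_iff zext_def split: zmax.splits)
  have "proj_eq (F_Fr m) (F_Fr n) (zext g) f' \<longleftrightarrow> (\<exists>c. f' = zext (\<lambda>x. g x + int n * c))" for f'
  proof
    assume "proj_eq (F_Fr m) (F_Fr n) (zext g) f'"
    then obtain a where a: "a \<noteq> 0" "f' = (\<lambda>x. smult (F_Fr n) a (zext g x))"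
      by (auto simp: proj_eq_def)
    then obtain c where "a = U c" by (cases a) (auto simp: zero_zmax_def)
    have "f' = zext (\<lambda>x. g x + int n * c)"
      unfolding a(2) \<open>a = U c\<close> M ..
    then show "\<exists>c. f' = zext (\<lambda>x. g x + int n * c)" ..
  next
    assume "\<exists>c. f' = zext (\<lambda>x. g x + int n * c)"
    then obtain c where c: "f' = zext (\<lambda>x. g x + int n * c)" ..
    show "proj_eq (F_Fr m) (F_Fr n) (zext g) f'"
      unfolding proj_eq_def
    proof
      show "\<exists>k\<ge>1. semilinear_wrt (Fr k) (F_Fr m) (F_Fr n) (zext g) \<and>
          semilinear_wrt (Fr k) (F_Fr m) (F_Fr n) f'"
        using S[of 0] S assms(4) c by auto
      show "\<exists>a. a \<noteq> 0 \<and> f' = (\<lambda>x. smult (F_Fr n) a (zext g x))"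
        unfolding c M[symmetric] by (intro exI[of _ "U c"]) (simp add: zero_zmax_def)
    qed
  qed
  then show ?thesis by (auto simp: parr_def proj_class_def)
qed

lemma zext_mem_parr:
  "degree_map k m n g \<Longrightarrow> 1 \<le> m \<Longrightarrow> 1 \<le> n \<Longrightarrow> 1 \<le> k \<Longrightarrow> zext g \<in> fst (snd (parr m n g))"
  using parr_eq[of k m n g] by (auto intro: exI[of _ 0])

text \<open>A map lies in its own class, so equal classes make one map a translate of the other. The
  two degrees may differ in the hypotheses, as needed when two epicyclic words of unknown degree are
  compared.\<close>

lemma parr_eq_iff:
  assumes "degree_map k m n g" "degree_map l m n h" "1 \<le> m" "1 \<le> n" "1 \<le> k" "1 \<le> l"
  shows "parr m n g = parr m n h \<longleftrightarrow> (\<exists>c. h = (\<lambda>x. g x + int n * c))"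
proof
  assume "parr m n g = parr m n h"
  then have "zext h \<in> fst (snd (parr m n g))"
    using zext_mem_parr[OF assms(2)] assms by simp
  then obtain c where "zext h = zext (\<lambda>x. g x + int n * c)"
    unfolding parr_eq[OF assms(1,3,4,5)] by auto
  then have "h = (\<lambda>x. g x + int n * c)" unfolding zext_eq_iff .
  then show "\<exists>c. h = (\<lambda>x. g x + int n * c)" ..
next
  assume "\<exists>c. h = (\<lambda>x. g x + int n * c)"
  then obtain c where c: "h = (\<lambda>x. g x + int n * c)" ..
  have "zext (\<lambda>x. g x + int n * d) = zext (\<lambda>x. h x + int n * (d - c))"
    "zext (\<lambda>x. h x + int n * d) = zext (\<lambda>x. g x + int n * (d + c))" for d
    by (simp_all add: c algebra_simps)
  then have "{zext (\<lambda>x. g x + int n * c) | c. True} = {zext (\<lambda>x. h x + int n * c) | c. True}"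
    by blast
  then show "parr m n g = parr m n h"
    by (simp only: parr_eq[OF assms(1,3,4,5)] parr_eq[OF assms(2,3,4,6)])
qed

section \<open>The category of projective classes of semilinear maps\<close>

lemma Src_parr [simp]: "Src PF (parr m n g) = F_Fr m"
  and Tgt_parr [simp]: "Tgt PF (parr m n g) = F_Fr n"
  and Idn_PF: "Idn PF (F_Fr n) = parr n n (\<lambda>x. x)"
  and Obj_PF: "Obj PF = {F_Fr n | n. 1 \<le> n}"
  by (simp_all add: PF_def parr_def proj_class_def zext_id)

lemma parr_in:
  assumes "degree_map k m n g" "1 \<le> m" "1 \<le> n" "1 \<le> k"
  shows "parr m n g \<in> Arr PF"
  using assms semilinear_wrt_zext[of m n k g] kernel_zext[of g]
  by (auto simp: PF_def parr_def semilinear_def)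

lemma Arr_PFE:
  assumes "f \<in> Arr PF"
  obtains k m n g where "1 \<le> k" "1 \<le> m" "1 \<le> n" "degree_map k m n g" "f = parr m n g"
  using assms unfolding PF_def parr_def by (auto elim!: semilinear_zextE)

text \<open>Since \<open>h\<close> has degree \<open>l\<close>, it turns a translation by
  \<open>n * d\<close> into one by \<open>p * l * d\<close>. Hence the elementwise composites of two
  classes are exactly the translates of \<open>h \<circ> g\<close>.\<close>

lemma Cmp_parr:
  assumes "degree_map k m n g" "degree_map l n p h" "1 \<le> m" "1 \<le> n" "1 \<le> p" "1 \<le> k" "1 \<le> l"
  shows "Cmp PF (parr n p h) (parr m n g) = parr m p (h \<circ> g)"
proof -
  have "(\<exists>f f'. F = f' \<circ> f \<and> (\<exists>c. f = zext (\<lambda>x. g x + int n * c)) \<and> (\<exists>c. f' = zext (\<lambda>x. h x + int p * c)))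
      \<longleftrightarrow> (\<exists>c. F = zext (\<lambda>x. (h \<circ> g) x + int p * c))" for F
  proof
    assume "\<exists>f f'. F = f' \<circ> f \<and> (\<exists>c. f = zext (\<lambda>x. g x + int n * c)) \<and> (\<exists>c. f' = zext (\<lambda>x. h x + int p * c))"
    then obtain c d where "F = zext (\<lambda>x. h x + int p * c) \<circ> zext (\<lambda>x. g x + int n * d)" by blast
    moreover have "(\<lambda>x. h x + int p * c) \<circ> (\<lambda>x. g x + int n * d)
        = (\<lambda>x. (h \<circ> g) x + int p * (int l * d + c))"
    proof
      fix x
      show "((\<lambda>x. h x + int p * c) \<circ> (\<lambda>x. g x + int n * d)) x
          = (h \<circ> g) x + int p * (int l * d + c)"
        using degree_map_mult[OF assms(2), of "g x" d] by (simp add: algebra_simps)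
    qed
    ultimately have "F = zext (\<lambda>x. (h \<circ> g) x + int p * (int l * d + c))"
      by (simp add: zext_comp)
    then show "\<exists>c. F = zext (\<lambda>x. (h \<circ> g) x + int p * c)" ..
  next
    assume "\<exists>c. F = zext (\<lambda>x. (h \<circ> g) x + int p * c)"
    then obtain c where "F = zext (\<lambda>x. (h \<circ> g) x + int p * c)" ..
    \<comment> \<open>The whole translation can be put on the outer map, with translation 0 on the
      inner one.\<close>
    then have "F = zext (\<lambda>x. h x + int p * c) \<circ> zext (\<lambda>x. g x + int n * 0)"
      by (simp add: zext_comp) (simp add: comp_def)
    then show "\<exists>f f'. F = f' \<circ> f \<and> (\<exists>c. f = zext (\<lambda>x. g x + int n * c)) \<and> (\<exists>c. f' = zext (\<lambda>x. h x + int p * c))"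
      by blast
  qed
  moreover have "degree_map (k * l) m p (h \<circ> g)" "1 \<le> k * l"
    using assms degree_map_comp by auto
  ultimately show ?thesis
    using parr_eq[OF assms(1)] parr_eq[OF assms(2)] parr_eq[of "k * l" m p "h \<circ> g"] assms(3-)
    by (simp add: PF_def)
qed

lemma degree_map_id: "degree_map 1 n n (\<lambda>x. x)"
  using degree_map_translate[of n 0] by simp

interpretation PF: category PF
proof
  fix f g assume f: "f \<in> Arr PF" and g: "g \<in> Arr PF" and fg: "Tgt PF f = Src PF g"
  obtain k m n f' where f': "1 \<le> k" "1 \<le> m" "1 \<le> n" "degree_map k m n f'" "f = parr m n f'"
    using f by (rule Arr_PFE)
  obtain l p g' where g': "1 \<le> l" "1 \<le> p" "degree_map l n p g'" "g = parr n p g'"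
    using g fg f' by (elim Arr_PFE) auto
  have C: "Cmp PF g f = parr m p (g' \<circ> f')"
    using f' g' Cmp_parr by simp
  have D: "degree_map (k * l) m p (g' \<circ> f')" "1 \<le> k * l"
    using f' g' degree_map_comp by auto
  show "Cmp PF g f \<in> Arr PF" "Src PF (Cmp PF g f) = Src PF f" "Tgt PF (Cmp PF g f) = Tgt PF g"
    using C D f' g' parr_in by auto
  fix h assume h: "h \<in> Arr PF" "Tgt PF g = Src PF h"
  obtain i q h' where h': "1 \<le> i" "1 \<le> q" "degree_map i p q h'" "h = parr p q h'"
    using h g' by (elim Arr_PFE) auto
  have "degree_map (l * i) n q (h' \<circ> g')" "1 \<le> l * i"
    using h' g' degree_map_comp by auto
  then show "Cmp PF h (Cmp PF g f) = Cmp PF (Cmp PF h g) f"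
    using D f' g' h' by (simp add: Cmp_parr comp_assoc)
next
  fix f assume "f \<in> Arr PF"
  then obtain k m n f' where f': "1 \<le> k" "1 \<le> m" "1 \<le> n" "degree_map k m n f'" "f = parr m n f'"
    by (rule Arr_PFE)
  show "Src PF f \<in> Obj PF" "Tgt PF f \<in> Obj PF"
    "Cmp PF f (Idn PF (Src PF f)) = f" "Cmp PF (Idn PF (Tgt PF f)) f = f"
    using f' Cmp_parr[OF degree_map_id f'(4)] Cmp_parr[OF f'(4) degree_map_id]
    by (auto simp: Obj_PF Idn_PF comp_def)
next
  fix a assume "a \<in> Obj PF"
  then show "Idn PF a \<in> Arr PF" "Src PF (Idn PF a) = a" "Tgt PF (Idn PF a) = a"
    by (auto simp: Obj_PF Idn_PF intro!: parr_in[OF degree_map_id])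
qed

section \<open>The subcategory of linear classes\<close>

lemma Fr_1: "Fr (Suc 0) = id"
  by (simp add: Fr_def fun_eq_iff)

lemma parr_in_PF1:
  assumes "degree_map 1 m n g" "1 \<le> m" "1 \<le> n"
  shows "parr m n g \<in> Arr PF1"
proof -
  obtain P where P: "parr m n g = (F_Fr m, P, F_Fr n)"
    by (simp add: parr_def proj_class_def)
  then have "zext g \<in> P" "(F_Fr m, P, F_Fr n) \<in> Arr PF"
    using zext_mem_parr[OF assms] parr_in[OF assms] by simp_all
  moreover have "linear (F_Fr m) (F_Fr n) (zext g)"
    using assms semilinear_wrt_zext[of m n 1 g] by (simp add: linear_def Fr_1)
  ultimately show ?thesis unfolding P PF1_def by auto
qed

text \<open>Linearity is demanded of only one member of the class. The members are translates of
  each other and share their degree, so the given representative has degree one as well.\<close>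

lemma Arr_PF1E:
  assumes "f \<in> Arr PF1"
  obtains m n g where "1 \<le> m" "1 \<le> n" "degree_map 1 m n g" "f = parr m n g"
proof -
  obtain E1 P E2 h where *: "f = (E1, P, E2)" "f \<in> Arr PF" "h \<in> P" "linear E1 E2 h"
    using assms by (auto simp: PF1_def)
  then obtain k m n g where f: "1 \<le> k" "1 \<le> m" "1 \<le> n" "degree_map k m n g" "f = parr m n g"
    by (elim Arr_PFE)
  then obtain c where c: "h = zext (\<lambda>x. g x + int n * c)" "E1 = F_Fr m" "E2 = F_Fr n"
    using * parr_eq by auto
  then have "degree_map 1 m n (\<lambda>x. g x + int n * c)"
    using * f semilinear_wrt_zext[of m n 1] by (simp add: linear_def Fr_1)
  \<comment> \<open>Translating back by the same amount returns to \<open>g\<close>.\<close>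
  from degree_map_add[OF this, of "- int n * c"] show ?thesis
    using that f by simp
qed

lemma PF1_sel [simp]: "Obj PF1 = Obj PF" "Src PF1 = Src PF" "Tgt PF1 = Tgt PF" "Idn PF1 = Idn PF"
    "Cmp PF1 = Cmp PF"
  by (simp_all add: PF1_def)

lemma PF1_sub: "f \<in> Arr PF1 \<Longrightarrow> f \<in> Arr PF"
  by (auto simp: PF1_def)

lemma category_PF1: "category PF1"
proof
  fix f g assume f: "f \<in> Arr PF1" and g: "g \<in> Arr PF1" and fg: "Tgt PF1 f = Src PF1 g"
  obtain m n f' where f': "1 \<le> m" "1 \<le> n" "degree_map 1 m n f'" "f = parr m n f'"
    using f by (rule Arr_PF1E)
  obtain p g' where g': "1 \<le> p" "degree_map 1 n p g'" "g = parr n p g'"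
    using g fg f' by (elim Arr_PF1E) auto
  have D: "degree_map 1 m p (g' \<circ> f')"
    using f' g' degree_map_comp[of 1 m n f' 1] by auto
  show "Cmp PF1 g f \<in> Arr PF1"
    using D f' g' parr_in_PF1 Cmp_parr[OF f'(3) g'(2)] by simp
next
  show "Idn PF1 a \<in> Arr PF1" if "a \<in> Obj PF1" for a
    using that by (auto simp: Obj_PF Idn_PF intro!: parr_in_PF1[OF degree_map_id])
qed (simp_all add: PF1_sub PF.Src_in PF.Tgt_in PF.Src_Idn PF.Tgt_Idn PF.Src_Cmp PF.Tgt_Cmp
    PF.Cmp_Idn_left PF.Cmp_Idn_right PF.Cmp_assoc)

section \<open>The simplicial category\<close>

lemma Delta_sel [simp]:
  "Obj Delta = UNIV" "Src Delta (m, f, n) = m" "Tgt Delta (m, f, n) = n"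
  "Idn Delta n = (n, \<lambda>i\<in>{..n}. i, n)"
  "Cmp Delta (n', g, p) (m, f, n) = (m, compose {..m} g f, p)"
  by (simp_all add: Delta_def)

lemma Arr_Delta_iff: "(m, f, n) \<in> Arr Delta \<longleftrightarrow> f \<in> {..m} \<rightarrow>\<^sub>E {..n} \<and> mono_on {..m} f"
  by (simp add: Delta_def)

lemma Arr_DeltaE:
  assumes "\<alpha> \<in> Arr Delta"
  obtains m f n where "\<alpha> = (m, f, n)" "f \<in> {..m} \<rightarrow>\<^sub>E {..n}" "mono_on {..m} f"
  using assms by (auto simp: Delta_def)

interpretation Delta: category Delta
proof
  fix \<alpha> \<beta> assume \<alpha>: "\<alpha> \<in> Arr Delta" and \<beta>: "\<beta> \<in> Arr Delta" and "Tgt Delta \<alpha> = Src Delta \<beta>"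
  then obtain m f n g p where *: "\<alpha> = (m, f, n)" "\<beta> = (n, g, p)" "f \<in> {..m} \<rightarrow>\<^sub>E {..n}" "mono_on {..m} f"
      "g \<in> {..n} \<rightarrow>\<^sub>E {..p}" "mono_on {..n} g"
    by (elim Arr_DeltaE) auto
  have "mono_on {..m} (compose {..m} g f)"
    using * by (auto simp: mono_on_def compose_def Pi_iff PiE_iff)
  then show "Cmp Delta \<beta> \<alpha> \<in> Arr Delta" using * by (auto simp: Arr_Delta_iff compose_def PiE_iff)
  show "Src Delta (Cmp Delta \<beta> \<alpha>) = Src Delta \<alpha>" "Tgt Delta (Cmp Delta \<beta> \<alpha>) = Tgt Delta \<beta>"
    using * by simp_all
  fix \<gamma> assume "\<gamma> \<in> Arr Delta" "Tgt Delta \<beta> = Src Delta \<gamma>"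
  then show "Cmp Delta \<gamma> (Cmp Delta \<beta> \<alpha>) = Cmp Delta (Cmp Delta \<gamma> \<beta>) \<alpha>"
    using * by (elim Arr_DeltaE) (auto simp: compose_def fun_eq_iff PiE_iff restrict_def)
qed (auto elim!: Arr_DeltaE simp: Arr_Delta_iff compose_def fun_eq_iff PiE_iff mono_on_def extensional_def restrict_def)

section \<open>Cofaces and codegeneracies generate the simplicial category\<close>

lemma coface_simps [simp]: "Src Delta (coface n j) = n - 1" "Tgt Delta (coface n j) = n"
  and codegen_simps [simp]: "Src Delta (codegen n j) = n + 1" "Tgt Delta (codegen n j) = n"
  by (simp_all add: coface_def codegen_def)

text \<open>A map identifying two neighbours factors through a codegeneracy, and a map missing a
  value factors through a coface. Either way the sum of the two ends drops by one for the remaining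
  factor. A map doing neither is strictly increasing and onto, hence an identity.\<close>

lemma Delta_induct [consumes 1, case_names Idn coface codegen Cmp]:
  assumes "\<alpha> \<in> Arr Delta"
    and Idn: "\<And>n. P (Idn Delta n)"
    and coface: "\<And>n j. 1 \<le> n \<Longrightarrow> j \<le> n \<Longrightarrow> P (coface n j)"
    and codegen: "\<And>n j. j \<le> n \<Longrightarrow> P (codegen n j)"
    and Cmp: "\<And>\<alpha> \<beta>. \<lbrakk>\<alpha> \<in> Arr Delta; \<beta> \<in> Arr Delta; Tgt Delta \<alpha> = Src Delta \<beta>; P \<alpha>; P \<beta>\<rbrakk>
      \<Longrightarrow> P (Cmp Delta \<beta> \<alpha>)"
  shows "P \<alpha>"
  using assms(1)
proof (induction "Src Delta \<alpha> + Tgt Delta \<alpha>" arbitrary: \<alpha> rule: less_induct)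
  case less
  obtain m f n where \<alpha>: "\<alpha> = (m, f, n)" and f: "f \<in> {..m} \<rightarrow>\<^sub>E {..n}" "mono_on {..m} f"
    using less.prems by (rule Arr_DeltaE)
  have f_le: "f i \<le> n" if "i \<le> m" for i using f that by auto
  have f_mono: "f i \<le> f j" if "i \<le> j" "j \<le> m" for i j using f that by (auto simp: mono_on_def)
  consider (deg) i where "i < m" "f i = f (Suc i)" | (miss) j where "j \<le> n" "j \<notin> f ` {..m}"
    | (id) "\<And>i. i < m \<Longrightarrow> f i < f (Suc i)" "{..n} \<subseteq> f ` {..m}"
    using f_mono by (metis Suc_leI atMost_iff le_eq_less_or_eq lessI subsetI)
  then show ?case
  proof cases
    case deg
    then obtain m' where m: "m = m' + 1" by (cases m) auto
    \<comment> \<open>The codegeneracy merges \<open>i\<close> and \<open>Suc i\<close>, so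
      \<open>g\<close> drops the argument \<open>Suc i\<close>.\<close>
    define g where "g = (\<lambda>j\<in>{..m'}. if j \<le> i then f j else f (Suc j))"
    have g: "(m', g, n) \<in> Arr Delta"
      using f_le f_mono deg m unfolding Arr_Delta_iff by (auto simp: g_def mono_on_def)
    have c: "codegen m' i \<in> Arr Delta" using deg m codegen_in by simp
    have "\<alpha> = Cmp Delta (m', g, n) (codegen m' i)"
    proof -
      have "f x = compose {..m} g (fst (snd (codegen m' i))) x" for x
      proof (cases "x \<le> m")
        case True
        \<comment> \<open>At this argument alone the codegeneracy moves \<open>x\<close> into the
          first branch of \<open>g\<close>, and there \<open>f (Suc i) = f i\<close> is
          used.\<close>
        moreover have "x = Suc i" if "\<not> x \<le> i" "x - 1 \<le> i" using that by linarith
        ultimately show ?thesis using deg m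
          by (auto simp: g_def codegen_def compose_def)
      next
        case False
        then show ?thesis using f by (auto simp: compose_def PiE_iff extensional_def)
      qed
      then show ?thesis using \<alpha> m by (simp add: codegen_def fun_eq_iff)
    qed
    moreover have "P (m', g, n)" using less.hyps[OF _ g] \<alpha> m by simp
    ultimately show ?thesis using Cmp[OF c g] codegen deg m by simp
  next
    case miss
    \<comment> \<open>A map into [0] misses nothing. This rules out truncation in the source
      \<open>n - 1\<close> of the coface.\<close>
    have "n \<noteq> 0"
    proof
      assume "n = 0"
      then have "f 0 = j" using miss f_le[of 0] by auto
      then show False using miss by auto
    qed
    then obtain n' where n: "n = n' + 1" by (cases n) auto
    define g where "g = (\<lambda>i\<in>{..m}. if f i < j then f i else f i - 1)"
    have ne: "f i \<noteq> j" if "i \<le> m" for i using miss that by auto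
    have g_le: "g i \<le> n'" if "i \<le> m" for i
      using f_le[OF that] ne[OF that] miss n that by (auto simp: g_def)
    have "g a \<le> g b" if "a \<le> b" "b \<le> m" for a b
      using f_mono[OF that] that by (auto simp: g_def)
    with g_le have g: "(m, g, n') \<in> Arr Delta"
      unfolding Arr_Delta_iff by (auto simp: mono_on_def g_def)
    have c: "coface n j \<in> Arr Delta" using n miss coface_in by simp
    have "\<alpha> = Cmp Delta (coface n j) (m, g, n')"
    proof -
      have "f x = compose {..m} (fst (snd (coface n j))) g x" for x
      proof (cases "x \<le> m")
        case True
        then show ?thesis using g_le[OF True] ne[OF True] n by (auto simp: g_def coface_def compose_def)
      next
        case False
        then show ?thesis using f by (auto simp: compose_def PiE_iff extensional_def)
      qed
      then show ?thesis using \<alpha> n by (simp add: coface_def fun_eq_iff)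
    qed
    moreover have "P (m, g, n')" using less.hyps[OF _ g] \<alpha> n by simp
    ultimately show ?thesis using Cmp[OF g c] coface[of n j] miss n by simp
  next
    case id
    \<comment> \<open>Strict increase gives \<open>i \<le> f i\<close>. For equality, take a
      preimage \<open>k\<close> of \<open>i\<close>: by induction it is not below \<open>i\<close>,
      so monotonicity gives \<open>f i \<le> f k = i\<close>.\<close>
    have ge: "i \<le> f i" if "i \<le> m" for i
      using that
    proof (induction i)
      case (Suc i)
      then show ?case using id(1)[of i] by simp
    qed simp
    have eq: "f i = i" if "i \<le> m" for i
      using that
    proof (induction i rule: less_induct)
      case (less i)
      have "i \<le> n" using ge[OF less.prems] f_le[OF less.prems] by simp
      then obtain k where k: "k \<le> m" "f k = i" using id(2) by (metis atMost_iff imageE subsetD)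
      show ?case
      proof (cases "k < i")
        case True
        then show ?thesis using less k by simp
      next
        case False
        then show ?thesis using f_mono[of i k] k ge[OF less.prems] by simp
      qed
    qed
    have "n = m"
    proof (rule antisym)
      obtain k where "k \<le> m" "f k = n" using id(2) by (metis atMost_iff imageE order_refl subsetD)
      then show "n \<le> m" using eq by simp
      show "m \<le> n" using eq[of m] f_le[of m] by simp
    qed
    moreover have "f = (\<lambda>i\<in>{..m}. i)"
      using f eq by (auto simp: fun_eq_iff PiE_iff extensional_def)
    ultimately show ?thesis using Idn[of n] \<alpha> by simp
  qed
qed

section \<open>Simplicial maps as periodic maps of the integers\<close>

definition zlift :: "simp_arr \<Rightarrow> int \<Rightarrow> int" where
  "zlift = (\<lambda>(m, f, n) x.
     (x div (int m + 1)) * (int n + 1) + int (f (nat (x mod (int m + 1)))))"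

lemma simp_map_zlift: "simp_map \<alpha> = zext (zlift \<alpha>)"
proof
  fix x show "simp_map \<alpha> x = zext (zlift \<alpha>) x"
    by (cases \<alpha>; cases x) (simp_all add: zlift_def)
qed

lemma zlift_nat: "i \<le> m \<Longrightarrow> zlift (m, f, n) (int i) = int (f i)"
  by (simp add: zlift_def)

text \<open>Within a block of length \<open>m + 1\<close> monotonicity is that of \<open>f\<close>;
  between blocks it follows from \<open>f \<le> n\<close>, which keeps each block of values below
  the start of the next one.\<close>

lemma degree_map_zlift:
  assumes "\<alpha> \<in> Arr Delta"
  shows "degree_map 1 (Src Delta \<alpha> + 1) (Tgt Delta \<alpha> + 1) (zlift \<alpha>)"
proof -
  obtain m f n where \<alpha>: "\<alpha> = (m, f, n)" and f: "f \<in> {..m} \<rightarrow>\<^sub>E {..n}" "mono_on {..m} f"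
    using assms by (rule Arr_DeltaE)
  have "zlift \<alpha> x \<le> zlift \<alpha> y" if "x \<le> y" for x y
  proof -
    let ?M = "int m + 1"
    have r: "nat (z mod ?M) \<le> m" "0 \<le> z mod ?M" for z
      using pos_mod_bound[of ?M z] by auto
    have "x div ?M \<le> y div ?M" using that by (intro zdiv_mono1) auto
    then consider "x div ?M = y div ?M" | "x div ?M + 1 \<le> y div ?M" by linarith
    then show ?thesis
    proof cases
      case 1
      then have "x mod ?M \<le> y mod ?M"
        using that by (metis add_le_cancel_left div_mult_mod_eq)
      then have "f (nat (x mod ?M)) \<le> f (nat (y mod ?M))"
        using f(2) r by (auto simp: mono_on_def)
      with 1 show ?thesis by (simp add: \<alpha> zlift_def)
    next
      case 2
      have "f (nat (x mod ?M)) \<le> n" using f(1) r[of x] by auto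
      then have "zlift \<alpha> x \<le> (x div ?M + 1) * (int n + 1)"
        by (simp add: \<alpha> zlift_def algebra_simps)
      also have "\<dots> \<le> (y div ?M) * (int n + 1)"
        using 2 by (intro mult_right_mono) auto
      also have "\<dots> \<le> zlift \<alpha> y" by (simp add: \<alpha> zlift_def)
      finally show ?thesis .
    qed
  qed
  moreover have "zlift \<alpha> (x + (int m + 1)) = zlift \<alpha> x + (int n + 1)" for x
  proof -
    have "(x + (int m + 1)) div (int m + 1) = x div (int m + 1) + 1"
      by (rule div_add_self2) simp
    moreover have "(x + (int m + 1)) mod (int m + 1) = x mod (int m + 1)"
      by (rule mod_add_self2)
    ultimately show ?thesis unfolding \<alpha> zlift_def prod.case by (simp only: algebra_simps)
  qed
  ultimately show ?thesis
    by (simp add: degree_map_def mono_def \<alpha> algebra_simps)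
qed

lemma zlift_eqI:
  assumes "\<alpha> \<in> Arr Delta" "degree_map 1 (Src Delta \<alpha> + 1) (Tgt Delta \<alpha> + 1) g"
    and "\<And>i. i \<le> Src Delta \<alpha> \<Longrightarrow> g (int i) = int (fst (snd \<alpha>) i)"
  shows "zlift \<alpha> = g"
  using degree_map_zlift[OF assms(1)] assms(2)
proof (rule degree_map_eqI)
  show "zlift \<alpha> (int i) = g (int i)" if "i < Src Delta \<alpha> + 1" for i
    using that assms(3)[of i] by (cases \<alpha>) (simp add: zlift_nat)
qed simp

lemma zlift_inj:
  assumes "\<alpha> \<in> Arr Delta" "\<beta> \<in> Arr Delta" "Src Delta \<alpha> = Src Delta \<beta>" "Tgt Delta \<alpha> = Tgt Delta \<beta>"
    and "zlift \<alpha> = zlift \<beta>"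
  shows "\<alpha> = \<beta>"
proof -
  obtain m f n g where *: "\<alpha> = (m, f, n)" "\<beta> = (m, g, n)" "f \<in> {..m} \<rightarrow>\<^sub>E {..n}" "g \<in> {..m} \<rightarrow>\<^sub>E {..n}"
    using assms by (elim Arr_DeltaE) auto
  have "f i = g i" if "i \<le> m" for i
    using zlift_nat[OF that, of f n] zlift_nat[OF that, of g n] assms(5) * by simp
  then have "f x = g x" for x
    using * by (cases "x \<le> m") (auto simp: PiE_iff extensional_def)
  then show ?thesis using * by auto
qed

lemma zlift_Idn: "zlift (Idn Delta n) = (\<lambda>x. x)"
  by (rule zlift_eqI) (use degree_map_id Delta.Idn_in[of n] in auto)

lemma zlift_Cmp:
  assumes "\<alpha> \<in> Arr Delta" "\<beta> \<in> Arr Delta" "Tgt Delta \<alpha> = Src Delta \<beta>"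
  shows "zlift (Cmp Delta \<beta> \<alpha>) = zlift \<beta> \<circ> zlift \<alpha>"
proof (rule zlift_eqI)
  show "Cmp Delta \<beta> \<alpha> \<in> Arr Delta" using assms by (rule Delta.Cmp_in)
  show "degree_map 1 (Src Delta (Cmp Delta \<beta> \<alpha>) + 1) (Tgt Delta (Cmp Delta \<beta> \<alpha>) + 1) (zlift \<beta> \<circ> zlift \<alpha>)"
    using degree_map_comp[OF degree_map_zlift[OF assms(1)], of 1] degree_map_zlift[OF assms(2)] assms
    by (simp add: Delta.Src_Cmp Delta.Tgt_Cmp)
  fix i assume "i \<le> Src Delta (Cmp Delta \<beta> \<alpha>)"
  then show "(zlift \<beta> \<circ> zlift \<alpha>) (int i) = int (fst (snd (Cmp Delta \<beta> \<alpha>)) i)"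
    using assms by (elim Arr_DeltaE) (auto simp: zlift_nat compose_def PiE_iff)
qed

section \<open>The cyclic category\<close>

lemma zlift_codegen: "i \<le> n + 1 \<Longrightarrow> zlift (codegen n j) (int i) = (if i \<le> j then int i else int i - 1)"
  by (simp add: codegen_def zlift_nat of_nat_diff)

lemma zlift_coface: "i \<le> n - 1 \<Longrightarrow> zlift (coface n j) (int i) = (if i < j then int i else int i + 1)"
  by (simp add: coface_def zlift_nat)

lemma zlift_shift:
  "\<alpha> \<in> Arr Delta \<Longrightarrow> zlift \<alpha> (x + (int (Src Delta \<alpha>) + 1) * c) = zlift \<alpha> x + (int (Tgt Delta \<alpha>) + 1) * c"
  using degree_map_mult[OF degree_map_zlift, of \<alpha> x c] by (simp add: algebra_simps)

text \<open>Among degree-one maps, those coming from the simplicial category change sign exactly at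
  0. This pins down the translation in a normal form.\<close>

lemma zlift_nonneg_iff:
  assumes "\<alpha> \<in> Arr Delta"
  shows "0 \<le> zlift \<alpha> x \<longleftrightarrow> 0 \<le> x"
proof -
  obtain m f n where \<alpha>: "\<alpha> = (m, f, n)" and f: "f \<in> {..m} \<rightarrow>\<^sub>E {..n}"
    using assms by (rule Arr_DeltaE)
  have mono: "mono (zlift \<alpha>)" using degree_map_zlift[OF assms] by (simp add: degree_map_def)
  have "0 \<le> zlift \<alpha> 0" using zlift_nat[of 0 m f n] \<alpha> by simp
  then have "0 \<le> zlift \<alpha> x" if "0 \<le> x" using monoD[OF mono that] by simp
  \<comment> \<open>The argument -1 is \<open>m\<close> moved back by one period, so its value is
    \<open>f m - (n + 1)\<close> with \<open>f m \<le> n\<close>.\<close>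
  moreover have "zlift \<alpha> (-1) < 0"
    using zlift_shift[OF assms, of "int m" "-1"] zlift_nat[of m m f n] PiE_mem[OF f, of m] \<alpha> by simp
  then have "zlift \<alpha> x < 0" if "x < 0" using monoD[OF mono, of x "-1"] that by simp
  ultimately show ?thesis by (meson not_le)
qed

section \<open>Cyclic words acting on the integers\<close>

interpretation Lam: adjoining Delta UNIV "\<lambda>n. n" "\<lambda>n. n" Lambda_rels ..

text \<open>Words act by actual integer maps instead of projective classes, so that powers of \<tau>
  stay visible as translations and normal forms can be compared.\<close>

fun zword :: "(simp_arr + nat) list \<Rightarrow> int \<Rightarrow> int" where
  "zword [] = (\<lambda>x. x)"
| "zword (Inl \<alpha> # w) = zlift \<alpha> \<circ> zword w"
| "zword (Inr n # w) = (\<lambda>x. x + (- 1)) \<circ> zword w"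

lemma degree_map_zword: "Lam.pth a b w \<Longrightarrow> degree_map 1 (a + 1) (b + 1) (zword w)"
proof (induction w arbitrary: b)
  case Nil
  then show ?case using degree_map_id by simp
next
  case (Cons x w)
  show ?case
  proof (cases x)
    case (Inl \<alpha>)
    then show ?thesis
      using Cons.prems degree_map_comp[OF Cons.IH[of "Src Delta \<alpha>"] degree_map_zlift[of \<alpha>]] by (auto simp: comp_def)
  next
    case (Inr n)
    then show ?thesis
      using Cons.prems degree_map_comp[OF Cons.IH[of b] degree_map_translate[of _ "- 1"]] by (auto simp: comp_def)
  qed
qed

lemma zword_append: "zword (v @ w) = zword v \<circ> zword w"
proof (induction v)
  case (Cons x v)
  then show ?case by (cases x) (auto simp: comp_assoc)
qed auto

lemma zword_replicate: "zword (replicate k (Inr n)) = (\<lambda>x. x - int k)"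
  by (induction k) (auto simp: fun_eq_iff)

definition simp_PF :: "simp_arr \<Rightarrow> zmax proj_arr" where
  "simp_PF \<alpha> = parr (Src Delta \<alpha> + 1) (Tgt Delta \<alpha> + 1) (zlift \<alpha>)"

definition tau_PF :: "nat \<Rightarrow> zmax proj_arr" where
  "tau_PF n = parr (n + 1) (n + 1) (\<lambda>x. x + (- 1))"

lemma eval_zword:
  "Lam.pth a b w \<Longrightarrow> eval_path PF (\<lambda>n. F_Fr (n + 1)) simp_PF tau_PF a w = parr (a + 1) (b + 1) (zword w)"
proof (induction w arbitrary: b)
  case Nil
  then show ?case by (simp add: Idn_PF)
next
  case (Cons x w)
  show ?case
  proof (cases x)
    case (Inl \<alpha>)
    then show ?thesis
      using Cons.prems Cons.IH[of "Src Delta \<alpha>"]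
        Cmp_parr[OF degree_map_zword[of a "Src Delta \<alpha>" w] degree_map_zlift[of \<alpha>]]
      by (auto simp: simp_PF_def comp_def)
  next
    case (Inr n)
    then show ?thesis
      using Cons.prems Cons.IH[of b] Cmp_parr[OF degree_map_zword[of a b w] degree_map_translate[of "b + 1" "- 1"]]
      by (auto simp: tau_PF_def comp_def)
  qed
qed

text \<open>The relation for the order of \<tau> holds only up to a translation by
  \<open>n + 1\<close>, which is projectively trivial. All other relations hold already between
  integer maps and are checked on a fundamental domain.\<close>

lemma Lambda_rels_zword:
  assumes "(v, w) \<in> Lambda_rels" "Lam.pth a b v" "Lam.pth a b w"
  shows "parr (a + 1) (b + 1) (zword v) = parr (a + 1) (b + 1) (zword w)"
proof -
  note deg = degree_map_zword[OF assms(2)] degree_map_zword[OF assms(3)]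
  have eqI: ?thesis if "\<And>i. i < a + 1 \<Longrightarrow> zword v (int i) = zword w (int i)"
    using degree_map_eqI[OF deg _ that] by simp
  \<comment> \<open>One or two letters \<tau> on the right push the arguments 0 and 1 down to -1 or
    -2. One period brings these back to the top of the fundamental domain; the period is
    \<open>n + 2\<close> for a codegeneracy and \<open>n\<close> for a coface.\<close>
  have neg: "zlift (codegen n j) (-1) = zlift (codegen n j) (int n + 1) - (int n + 1)"
    "zlift (codegen n j) (-2) = zlift (codegen n j) (int n) - (int n + 1)" if "j \<le> n" for n j
    using zlift_shift[OF codegen_in[OF that], of "int n + 1" "-1"]
      zlift_shift[OF codegen_in[OF that], of "int n" "-1"] by simp_all
  have neg': "zlift (coface n j) (-1) = zlift (coface n j) (int n - 1) - (int n + 1)"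
    if "1 \<le> n" "j \<le> n" for n j
    using zlift_shift[OF coface_in[OF that], of "int n - 1" "-1"] that by (simp add: of_nat_diff)
  have top: "zlift (codegen n j) (int n + 1) = int n" "zlift (codegen n j) (int n) = (if n \<le> j then int n else int n - 1)"
    if "j \<le> n" for n j
    using zlift_codegen[of "n + 1" n j] zlift_codegen[of n n j] that by (simp_all add: add.commute)
  have top': "zlift (coface n j) (int n - 1) = (if n - 1 < j then int n - 1 else int n)" if "1 \<le> n" for n j
    using zlift_coface[of "n - 1" n j] that by (simp add: of_nat_diff)
  consider (1) n where "v = replicate (n + 1) (Inr n)" "w = []"
    | (2) n where "v = [Inr n, Inl (codegen n 0)]" "w = [Inl (codegen n n), Inr (n + 1), Inr (n + 1)]"
    | (3) n j where "v = [Inr n, Inl (codegen n j)]" "w = [Inl (codegen n (j - 1)), Inr (n + 1)]" "1 \<le> j" "j \<le> n"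
    | (4) n j where "v = [Inr n, Inl (coface n j)]" "w = [Inl (coface n (j - 1)), Inr (n - 1)]" "1 \<le> j" "j \<le> n"
    | (5) n where "v = [Inr n, Inl (coface n 0)]" "w = [Inl (coface n n)]" "1 \<le> n"
    using assms(1) unfolding Lambda_rels_def by blast
  then show ?thesis
  proof cases
    case 1
    have "n = b" using assms(2) 1 by simp
    moreover have "a = b" using assms(3) 1 by simp
    \<comment> \<open>The word \<open>v\<close> translates by \<open>- (n + 1)\<close>, so adding
      one multiple of \<open>b + 1\<close> gives the identity.\<close>
    moreover have "(\<exists>c. zword w = (\<lambda>x. zword v x + int (b + 1) * c))"
      using 1 \<open>n = b\<close> by (intro exI[of _ 1]) (simp add: zword_replicate del: replicate.simps)
    ultimately show ?thesis using parr_eq_iff[OF deg] by simp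
  next
    case 2
    have a: "a = n + 1" using assms(2) 2 by simp
    show ?thesis
    proof (rule eqI)
      fix i assume i: "i < a + 1"
      consider "i = 0" | "i = 1" | k where "i = k + 2"
        by (metis One_nat_def add_2_eq_Suc' not0_implies_Suc)
      then show "zword v (int i) = zword w (int i)"
      proof cases
        case 3
        then show ?thesis using 2 i a zlift_codegen[of "k + 2" n 0] zlift_codegen[of k n n] by simp
      qed (use 2 zlift_codegen[of 0 n 0] zlift_codegen[of 1 n 0] neg[of n n] top[of n n] in simp_all)
    qed
  next
    case 3
    have a: "a = n + 1" using assms(2) 3 by simp
    show ?thesis
    proof (rule eqI)
      fix i assume i: "i < a + 1"
      show "zword v (int i) = zword w (int i)"
      proof (cases i)
        case 0
        then show ?thesis using 3 zlift_codegen[of 0 n j] neg[of "j - 1" n] top[of "j - 1" n] by simp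
      next
        case (Suc k)
        then show ?thesis using 3 i a zlift_codegen[of i n j] zlift_codegen[of k n "j - 1"] by auto
      qed
    qed
  next
    case 4
    have a: "a = n - 1" using assms(2) 4 by simp
    show ?thesis
    proof (rule eqI)
      fix i assume i: "i < a + 1"
      show "zword v (int i) = zword w (int i)"
      proof (cases i)
        case 0
        then show ?thesis using 4 zlift_coface[of 0 n j] neg'[of n "j - 1"] top'[of n "j - 1"] by auto
      next
        case (Suc k)
        then show ?thesis using 4 i a zlift_coface[of i n j] zlift_coface[of k n "j - 1"] by auto
      qed
    qed
  next
    case 5
    have a: "a = n - 1" using assms(2) 5 by simp
    show ?thesis
    proof (rule eqI)
      fix i assume "i < a + 1"
      then show "zword v (int i) = zword w (int i)"
        using 5 a zlift_coface[of i n 0] zlift_coface[of i n n] by simp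
    qed
  qed
qed

interpretation LF: adjoining_functor Delta UNIV "\<lambda>n. n" "\<lambda>n. n" Lambda_rels PF "\<lambda>n. F_Fr (n + 1)"
  simp_PF tau_PF
proof
  show "F_Fr (n + 1) \<in> Obj PF" for n by (auto simp: Obj_PF)
  show "simp_PF \<alpha> \<in> Arr PF" if "\<alpha> \<in> Arr Delta" for \<alpha>
    unfolding simp_PF_def by (rule parr_in[OF degree_map_zlift[OF that]]) auto
  show "tau_PF n \<in> Arr PF" for n
    unfolding tau_PF_def by (rule parr_in[OF degree_map_translate]) auto
  show "simp_PF (Idn Delta n) = Idn PF (F_Fr (n + 1))" for n
    using zlift_Idn[of n] by (simp add: simp_PF_def Idn_PF)
  show "simp_PF (Cmp Delta \<beta> \<alpha>) = Cmp PF (simp_PF \<beta>) (simp_PF \<alpha>)"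
    if "\<alpha> \<in> Arr Delta" "\<beta> \<in> Arr Delta" "Tgt Delta \<alpha> = Src Delta \<beta>" for \<alpha> \<beta>
    using Cmp_parr[OF degree_map_zlift[OF that(1)] degree_map_zlift[OF that(2), folded that(3)]] that
    by (simp add: simp_PF_def zlift_Cmp Delta.Src_Cmp Delta.Tgt_Cmp)
  show "eval_path PF (\<lambda>n. F_Fr (n + 1)) simp_PF tau_PF a v = eval_path PF (\<lambda>n. F_Fr (n + 1)) simp_PF tau_PF a w"
    if "(v, w) \<in> Lambda_rels" "Lam.pth a b v" "Lam.pth a b w" for v w a b
    unfolding eval_zword[OF that(2)] eval_zword[OF that(3)] by (rule Lambda_rels_zword[OF that])
qed (simp_all add: simp_PF_def tau_PF_def)

section \<open>Normal forms of cyclic words\<close>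

definition normalizable :: "nat \<Rightarrow> nat \<Rightarrow> (simp_arr + nat) list \<Rightarrow> bool" where
  "normalizable a b w \<longleftrightarrow> (\<exists>\<alpha> j. \<alpha> \<in> Arr Delta \<and> Src Delta \<alpha> = a \<and> Tgt Delta \<alpha> = b \<and>
     Lam.cong a b w (Inl \<alpha> # replicate j (Inr a)))"

lemma path_replicate: "Lam.pth a a (replicate j (Inr a))"
  by (induction j) auto

lemma normalizable_cong: "Lam.cong a b v w \<Longrightarrow> normalizable a b w \<Longrightarrow> normalizable a b v"
  unfolding normalizable_def using Lam.cong_trans by blast

lemma normalizable_append:
  assumes "normalizable a b w"
  shows "normalizable a b (w @ replicate k (Inr a))"
proof -
  obtain \<alpha> j where *: "\<alpha> \<in> Arr Delta" "Src Delta \<alpha> = a" "Tgt Delta \<alpha> = b"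
      "Lam.cong a b w (Inl \<alpha> # replicate j (Inr a))"
    using assms by (auto simp: normalizable_def)
  have "Lam.cong a b (w @ replicate k (Inr a)) (Inl \<alpha> # replicate (j + k) (Inr a))"
    using Lam.cong_appendR[OF *(4) path_replicate] by (simp add: replicate_add)
  then show ?thesis unfolding normalizable_def using * by blast
qed

lemma normalizable_Inl:
  assumes "normalizable a b w" "\<beta> \<in> Arr Delta" "Src Delta \<beta> = b" "Tgt Delta \<beta> = c"
  shows "normalizable a c (Inl \<beta> # w)"
proof -
  obtain \<alpha> j where *: "\<alpha> \<in> Arr Delta" "Src Delta \<alpha> = a" "Tgt Delta \<alpha> = b"
      "Lam.cong a b w (Inl \<alpha> # replicate j (Inr a))"
    using assms by (auto simp: normalizable_def)
  have "Lam.cong a c ([Inl \<beta>] @ w) ([Inl \<beta>] @ Inl \<alpha> # replicate j (Inr a))"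
    by (rule Lam.cong_appendL[OF _ *(4)]) (use assms in simp)
  moreover have "Lam.cong a c ([Inl \<beta>, Inl \<alpha>] @ replicate j (Inr a)) ([Inl (Cmp Delta \<beta> \<alpha>)] @ replicate j (Inr a))"
    by (rule Lam.cong_appendR[OF Lam.cong_Cmp path_replicate]) (use assms * in auto)
  ultimately have "Lam.cong a c (Inl \<beta> # w) (Inl (Cmp Delta \<beta> \<alpha>) # replicate j (Inr a))"
    using Lam.cong_trans by simp
  moreover have "Cmp Delta \<beta> \<alpha> \<in> Arr Delta" "Src Delta (Cmp Delta \<beta> \<alpha>) = a" "Tgt Delta (Cmp Delta \<beta> \<alpha>) = c"
    using assms * by (simp_all add: Delta.Cmp_in Delta.Src_Cmp Delta.Tgt_Cmp)
  ultimately show ?thesis unfolding normalizable_def by blast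
qed

lemma normalizable_arr: "\<alpha> \<in> Arr Delta \<Longrightarrow> normalizable (Src Delta \<alpha>) (Tgt Delta \<alpha>) [Inl \<alpha>]"
  unfolding normalizable_def by (intro exI[of _ \<alpha>] exI[of _ 0]) (simp add: Lam.cong_refl)

text \<open>A block of \<tau> is moved past a composite by moving it past the outer map first and
  then moving the resulting block past the inner one. The relations can change the number of letters
  \<tau>, so the statement must cover all exponents at once.\<close>

lemma normalizable_tau:
  "\<alpha> \<in> Arr Delta \<Longrightarrow> normalizable (Src Delta \<alpha>) (Tgt Delta \<alpha>) (replicate i (Inr (Tgt Delta \<alpha>)) @ [Inl \<alpha>])"
proof (induction \<alpha> arbitrary: i rule: Delta_induct)
  case (Idn n)
  have I: "Lam.cong n n [Inl (Idn Delta n)] []" by (rule Lam.cong_Idn) simp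
  have "Lam.cong n n (replicate i (Inr n) @ [Inl (Idn Delta n)]) (replicate i (Inr n) @ [])"
    by (rule Lam.cong_appendL[OF path_replicate I])
  moreover have "Lam.cong n n ([] @ replicate i (Inr n)) ([Inl (Idn Delta n)] @ replicate i (Inr n))"
    by (rule Lam.cong_appendR[OF Lam.cong_sym[OF I] path_replicate])
  ultimately have "Lam.cong n n (replicate i (Inr n) @ [Inl (Idn Delta n)]) ([Inl (Idn Delta n)] @ replicate i (Inr n))"
    using Lam.cong_trans by simp
  then show ?case
    using normalizable_cong normalizable_append[OF normalizable_arr[OF Delta.Idn_in[of n]], of i] by simp
next
  case (coface n j)
  have "normalizable (n - 1) n (replicate i (Inr n) @ [Inl (coface n j)])"
    using coface(2)
  proof (induction i arbitrary: j)
    case 0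
    then show ?case using normalizable_arr[OF coface_in[OF coface(1) 0]] by simp
  next
    case (Suc i)
    \<comment> \<open>Passing one \<tau> lowers the index of the coface by one. At index 0 the
      \<tau> disappears and the index jumps to \<open>n\<close>, so the induction on the block keeps
      the index arbitrary.\<close>
    define u where "u = (if j = 0 then [Inl (coface n n)] else [Inl (coface n (j - 1)), Inr (n - 1)])"
    have "Lam.cong (n - 1) n [Inr n, Inl (coface n j)] u"
    proof (rule Lam.cong_rel)
      show "([Inr n, Inl (coface n j)], u) \<in> Lambda_rels"
        using coface(1) Suc.prems by (cases j) (auto simp: u_def Lambda_rels_def)
    qed (use coface(1) Suc.prems coface_in in \<open>auto simp: u_def\<close>)
    from Lam.cong_appendL[OF path_replicate[of n i] this]
    have "Lam.cong (n - 1) n (replicate (Suc i) (Inr n) @ [Inl (coface n j)]) (replicate i (Inr n) @ u)"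
      by (simp add: replicate_app_Cons_same)
    moreover have "normalizable (n - 1) n (replicate i (Inr n) @ u)"
      using Suc.IH[of n] normalizable_append[OF Suc.IH[of "j - 1"], of 1] Suc.prems by (simp add: u_def)
    ultimately show ?case by (rule normalizable_cong)
  qed
  then show ?case by simp
next
  case (codegen n j)
  have "normalizable (n + 1) n (replicate i (Inr n) @ [Inl (codegen n j)])"
    using codegen
  proof (induction i arbitrary: j)
    case 0
    then show ?case using normalizable_arr[OF codegen_in[OF 0]] by simp
  next
    case (Suc i)
    \<comment> \<open>At index 0 the codegeneracy jumps to index \<open>n\<close> and emits two
      letters \<tau> instead of one.\<close>
    define l where "l = (if j = 0 then n else j - 1)"
    define u where "u = [Inl (codegen n l)] @ replicate (if j = 0 then 2 else 1) (Inr (n + 1))"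
    have "Lam.cong (n + 1) n [Inr n, Inl (codegen n j)] u"
    proof (rule Lam.cong_rel)
      show "([Inr n, Inl (codegen n j)], u) \<in> Lambda_rels"
        using Suc.prems by (cases j) (auto simp: u_def l_def Lambda_rels_def numeral_2_eq_2)
    qed (use Suc.prems codegen_in in \<open>auto simp: u_def l_def numeral_2_eq_2\<close>)
    from Lam.cong_appendL[OF path_replicate[of n i] this]
    have "Lam.cong (n + 1) n (replicate (Suc i) (Inr n) @ [Inl (codegen n j)]) (replicate i (Inr n) @ u)"
      by (simp add: replicate_app_Cons_same)
    moreover have "normalizable (n + 1) n (replicate i (Inr n) @ u)"
    proof -
      have "l \<le> n" using Suc.prems by (auto simp: l_def)
      from normalizable_append[OF Suc.IH[OF this]] show ?thesis
        by (simp add: u_def del: replicate.simps)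
    qed
    ultimately show ?case by (rule normalizable_cong)
  qed
  then show ?case by simp
next
  case (Cmp \<alpha> \<beta>)
  define a where "a = Src Delta \<alpha>"
  define b where "b = Src Delta \<beta>"
  define c where "c = Tgt Delta \<beta>"
  obtain \<gamma> j where \<gamma>: "\<gamma> \<in> Arr Delta" "Src Delta \<gamma> = b" "Tgt Delta \<gamma> = c"
      "Lam.cong b c (replicate i (Inr c) @ [Inl \<beta>]) (Inl \<gamma> # replicate j (Inr b))"
    using Cmp.IH(2)[of i] by (auto simp: normalizable_def b_def c_def)
  have "Lam.cong a c [Inl (Cmp Delta \<beta> \<alpha>)] [Inl \<beta>, Inl \<alpha>]"
    by (rule Lam.cong_sym[OF Lam.cong_Cmp]) (use Cmp.hyps in \<open>auto simp: a_def c_def\<close>)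
  from Lam.cong_appendL[OF path_replicate[of c i] this]
  have "Lam.cong a c (replicate i (Inr c) @ [Inl (Cmp Delta \<beta> \<alpha>)]) ((replicate i (Inr c) @ [Inl \<beta>]) @ [Inl \<alpha>])"
    by simp
  moreover have "Lam.cong a c ((replicate i (Inr c) @ [Inl \<beta>]) @ [Inl \<alpha>]) ((Inl \<gamma> # replicate j (Inr b)) @ [Inl \<alpha>])"
    by (rule Lam.cong_appendR[OF \<gamma>(4)]) (use Cmp.hyps in \<open>simp add: a_def b_def\<close>)
  moreover have "normalizable a c (Inl \<gamma> # (replicate j (Inr b) @ [Inl \<alpha>]))"
    using normalizable_Inl[OF Cmp.IH(1)[of j] \<gamma>(1)] \<gamma>(2,3) Cmp.hyps by (simp add: a_def b_def)
  ultimately have "normalizable a c (replicate i (Inr c) @ [Inl (Cmp Delta \<beta> \<alpha>)])"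
    by (auto intro: normalizable_cong)
  then show ?case using Cmp.hyps by (simp add: Delta.Src_Cmp Delta.Tgt_Cmp a_def c_def)
qed

lemma normalizable_path: "Lam.pth a b w \<Longrightarrow> normalizable a b w"
proof (induction w arbitrary: b)
  case Nil
  then show ?case
    using normalizable_cong[OF Lam.cong_sym[OF Lam.cong_Idn]] normalizable_arr[OF Delta.Idn_in[of a]] by simp
next
  case (Cons x w)
  show ?case
  proof (cases x)
    case (Inl \<alpha>)
    then show ?thesis using Cons.prems Cons.IH[of "Src Delta \<alpha>"] by (auto intro: normalizable_Inl)
  next
    case (Inr n)
    then have n: "n = b" and "Lam.pth a b w" using Cons.prems by auto
    then obtain \<alpha> j where *: "\<alpha> \<in> Arr Delta" "Src Delta \<alpha> = a" "Tgt Delta \<alpha> = b"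
        "Lam.cong a b w (Inl \<alpha> # replicate j (Inr a))"
      using Cons.IH[of b] by (auto simp: normalizable_def)
    have "Lam.cong a b ([Inr b] @ w) ([Inr b] @ Inl \<alpha> # replicate j (Inr a))"
      by (rule Lam.cong_appendL[OF _ *(4)]) simp
    moreover have "normalizable a b ([Inr b] @ Inl \<alpha> # replicate j (Inr a))"
      using normalizable_append[OF normalizable_tau[OF *(1), of 1], of j] * by simp
    ultimately show ?thesis using Inr n normalizable_cong by simp
  qed
qed

section \<open>Faithfulness and fullness for the cyclic category\<close>

lemma tau_power_cong: "Lam.cong a a (replicate (i + (a + 1) * c) (Inr a)) (replicate i (Inr a))"
proof (induction c)
  case (Suc c)
  have "Lam.cong a a (replicate (a + 1) (Inr a)) []"
    by (rule Lam.cong_rel) (use path_replicate[of a "a + 1"] in \<open>auto simp: Lambda_rels_def\<close>)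
  from Lam.cong_appendR[OF this path_replicate[of a "i + (a + 1) * c"]]
  have "Lam.cong a a (replicate (i + (a + 1) * Suc c) (Inr a)) (replicate (i + (a + 1) * c) (Inr a))"
    by (simp add: replicate_add[symmetric] algebra_simps)
  then show ?case using Suc Lam.cong_trans by blast
qed (simp add: Lam.cong_refl path_replicate)

lemma tau_power_cong':
  assumes "int i - int j = (int a + 1) * c"
  shows "Lam.cong a a (replicate i (Inr a)) (replicate j (Inr a))"
proof (cases "0 \<le> c")
  case True
  then have "int i = int (j + (a + 1) * nat c)" using assms by (simp add: algebra_simps)
  then have "i = j + (a + 1) * nat c" by (simp only: of_nat_eq_iff)
  then show ?thesis using tau_power_cong by simp
next
  case False
  then have "int j = int (i + (a + 1) * nat (- c))" using assms by (simp add: algebra_simps)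
  then have "j = i + (a + 1) * nat (- c)" by (simp only: of_nat_eq_iff)
  then show ?thesis using Lam.cong_sym[OF tau_power_cong] by simp
qed

text \<open>Two normal forms with the same class have simplicial lifts that differ by a translation
  of the argument. Both lifts change sign at 0, so the translation vanishes: the simplicial parts
  agree, and the exponents of \<tau> agree modulo \<open>a + 1\<close>.\<close>

lemma Lambda_faithful:
  assumes v: "Lam.pth a b v" and w: "Lam.pth a b w"
    and eq: "parr (a + 1) (b + 1) (zword v) = parr (a + 1) (b + 1) (zword w)"
  shows "Lam.cong a b v w"
proof -
  obtain \<alpha> i where \<alpha>: "\<alpha> \<in> Arr Delta" "Src Delta \<alpha> = a" "Tgt Delta \<alpha> = b"
      "Lam.cong a b v (Inl \<alpha> # replicate i (Inr a))"
    using normalizable_path[OF v] by (auto simp: normalizable_def)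
  obtain \<beta> j where \<beta>: "\<beta> \<in> Arr Delta" "Src Delta \<beta> = a" "Tgt Delta \<beta> = b"
      "Lam.cong a b w (Inl \<beta> # replicate j (Inr a))"
    using normalizable_path[OF w] by (auto simp: normalizable_def)
  \<comment> \<open>Congruent words have equal classes because the class is the value of a functor
    defined by generators and relations.\<close>
  have inv: "parr (a + 1) (b + 1) (zword x) = parr (a + 1) (b + 1) (zword y)" if "Lam.cong a b x y" for x y
    using LF.ev_cong[OF that] Lam.cong_path[OF that] eval_zword by metis
  have p: "Lam.pth a b (Inl \<alpha> # replicate i (Inr a))" "Lam.pth a b (Inl \<beta> # replicate j (Inr a))"
    using \<alpha>(4) \<beta>(4) Lam.cong_path by blast+
  have "parr (a + 1) (b + 1) (zword (Inl \<alpha> # replicate i (Inr a))) = parr (a + 1) (b + 1) (zword (Inl \<beta> # replicate j (Inr a)))"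
    using inv[OF \<alpha>(4)] inv[OF \<beta>(4)] eq by simp
  then obtain c where "zword (Inl \<beta> # replicate j (Inr a)) = (\<lambda>x. zword (Inl \<alpha> # replicate i (Inr a)) x + int (b + 1) * c)"
    using parr_eq_iff[OF degree_map_zword[OF p(1)] degree_map_zword[OF p(2)]] by auto
  then have "zlift \<beta> (x - int j) = zlift \<alpha> (x - int i) + (int b + 1) * c" for x
    by (simp add: zword_replicate fun_eq_iff add.commute)
  \<comment> \<open>The projective ambiguity after \<open>\<alpha>\<close> is traded for a
    translation by periods before it.\<close>
  then have "zlift \<beta> (x - int j) = zlift \<alpha> (x - int i + (int a + 1) * c)" for x
    using zlift_shift[OF \<alpha>(1)] \<alpha>(2,3) by simp
  from this[of "x + int j" for x]
  have shift: "zlift \<beta> x = zlift \<alpha> (x + (int j - int i + (int a + 1) * c))" for x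
    by (simp add: algebra_simps)
  define d where "d = int j - int i + (int a + 1) * c"
  \<comment> \<open>Comparing signs at 0 and -1 gives \<open>0 \<le> d\<close> and
    \<open>d - 1 < 0\<close>.\<close>
  have "zlift \<beta> 0 = zlift \<alpha> d" "zlift \<beta> (- 1) = zlift \<alpha> (d - 1)"
    using shift[of 0] shift[of "- 1"] by (simp_all add: d_def algebra_simps)
  then have "0 \<le> d" "\<not> 0 \<le> d - 1"
    using zlift_nonneg_iff[OF \<alpha>(1), of d] zlift_nonneg_iff[OF \<alpha>(1), of "d - 1"]
      zlift_nonneg_iff[OF \<beta>(1), of 0] zlift_nonneg_iff[OF \<beta>(1), of "- 1"]
    by simp_all
  then have d: "d = 0" by simp
  then have "zlift \<beta> = zlift \<alpha>" using shift by (simp add: d_def fun_eq_iff)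
  then have "\<beta> = \<alpha>" using zlift_inj \<alpha> \<beta> by simp
  moreover have "int i - int j = (int a + 1) * c" using d by (simp add: d_def)
  then have "Lam.cong a b ([Inl \<alpha>] @ replicate i (Inr a)) ([Inl \<alpha>] @ replicate j (Inr a))"
    by (intro Lam.cong_appendL[OF _ tau_power_cong']) (use \<alpha> in auto)
  ultimately show ?thesis
    using \<alpha>(4) Lam.cong_sym[OF \<beta>(4)] Lam.cong_trans by (metis append_Cons append_Nil)
qed

text \<open>If \<open>j\<close> is the place where \<open>g\<close> becomes nonnegative, then
  \<open>g\<close> shifted by \<open>j\<close> sends 0, ..., a into 0, ..., b. It is therefore the
  lift of a simplicial map, and the shift is undone by a power of \<tau>.\<close>

lemma Lambda_full:
  assumes g: "degree_map 1 (a + 1) (b + 1) g"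
  shows "\<exists>w. Lam.pth a b w \<and> parr (a + 1) (b + 1) (zword w) = parr (a + 1) (b + 1) g"
proof -
  have shift: "g (x + (int a + 1) * c) = g x + (int b + 1) * c" for x c
    using degree_map_mult[OF g, of x c] by (simp add: algebra_simps)
  have mono: "g x \<le> g y" if "x \<le> y" for x y using g that by (simp add: degree_map_def mono_def)
  \<comment> \<open>At this multiple of the period \<open>g\<close> is certainly negative, while at
    \<open>(int a + 1) * \<bar>g 0\<bar>\<close> it is nonnegative. The search for the sign change
    can thus run over natural offsets from \<open>z\<close>.\<close>
  define z where "z = (int a + 1) * (- \<bar>g 0\<bar> - 1)"
  have pos: "0 \<le> int b * \<bar>g 0\<bar>" by simp
  then have "0 \<le> g 0 + (int b + 1) * \<bar>g 0\<bar>" unfolding distrib_right by linarith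
  then have "0 \<le> g (z + int (nat ((int a + 1) * \<bar>g 0\<bar> - z)))"
    using shift[of 0 "\<bar>g 0\<bar>"] by (simp add: z_def algebra_simps)
  then have ex: "0 \<le> g (z + int (LEAST k. 0 \<le> g (z + int k)))" by (rule LeastI)
  define l where "l = (LEAST k. 0 \<le> g (z + int k))"
  have "g z < 0"
  proof -
    have "(int b + 1) * (- \<bar>g 0\<bar> - 1) = - (int b * \<bar>g 0\<bar>) - int b - \<bar>g 0\<bar> - 1"
      by (simp add: algebra_simps)
    moreover have "g z = g 0 + (int b + 1) * (- \<bar>g 0\<bar> - 1)"
      using shift[of 0 "- \<bar>g 0\<bar> - 1"] by (simp add: z_def)
    ultimately show ?thesis using pos by linarith
  qed
  \<comment> \<open>Offset 0 is excluded by \<open>g z < 0\<close>, so \<open>l - 1\<close> is a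
    genuine earlier offset and minimality makes \<open>g\<close> negative there.\<close>
  then have "l \<noteq> 0" using ex unfolding l_def[symmetric] by (cases "l = 0") auto
  then have "\<not> 0 \<le> g (z + int (l - 1))"
    using not_less_Least[of "l - 1" "\<lambda>k. 0 \<le> g (z + int k)"] unfolding l_def[symmetric] by simp
  moreover define j where "j = z + int l"
  ultimately have j: "0 \<le> g j" "g (j - 1) < 0"
    using ex \<open>l \<noteq> 0\<close> by (auto simp: l_def[symmetric] j_def of_nat_diff algebra_simps)
  have ge: "0 \<le> g (int i + j)" for i using mono[of j "int i + j"] j by simp
  \<comment> \<open>The argument is at most one period after \<open>j - 1\<close>, where
    \<open>g\<close> is negative, so the value stays below \<open>b + 1\<close>.\<close>
  have le: "g (int i + j) \<le> int b" if "i \<le> a" for i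
    using mono[of "int i + j" "j - 1 + (int a + 1) * 1"] that j shift[of "j - 1" 1] by simp
  define \<alpha> where "\<alpha> = (a, \<lambda>i\<in>{..a}. nat (g (int i + j)), b)"
  have \<alpha>: "\<alpha> \<in> Arr Delta"
    unfolding \<alpha>_def Arr_Delta_iff using le ge mono by (auto simp: mono_on_def nat_le_iff intro!: nat_mono)
  have zl: "zlift \<alpha> = (\<lambda>x. g (x + j))"
  proof (rule zlift_eqI[OF \<alpha>])
    have "degree_map (1 * 1) (a + 1) (b + 1) (g \<circ> (\<lambda>x. x + j))"
      by (rule degree_map_comp[OF degree_map_translate g])
    then show "degree_map 1 (Src Delta \<alpha> + 1) (Tgt Delta \<alpha> + 1) (\<lambda>x. g (x + j))"
      by (simp add: \<alpha>_def comp_def)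
  qed (use ge in \<open>simp add: \<alpha>_def\<close>)
  \<comment> \<open>The shift \<open>j\<close> may be negative but the exponent of \<tau> is
    natural. Adding \<open>\<bar>j\<bar>\<close> periods repairs this and changes the result only by
    a multiple of \<open>b + 1\<close>.\<close>
  define k where "k = nat (j + (int a + 1) * \<bar>j\<bar>)"
  have "0 \<le> int a * \<bar>j\<bar>" by simp
  then have "0 \<le> j + (int a + 1) * \<bar>j\<bar>" unfolding distrib_right by linarith
  then have "x - int k + j = x + (int a + 1) * (- \<bar>j\<bar>)" for x by (simp add: k_def)
  then have "zlift \<alpha> (x - int k) = g x + int (b + 1) * (- \<bar>j\<bar>)" for x
    using shift[of x "- \<bar>j\<bar>"] by (simp only: zl of_nat_add of_nat_1)
  then have z: "zword (Inl \<alpha> # replicate k (Inr a)) = (\<lambda>x. g x + int (b + 1) * (- \<bar>j\<bar>))"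
    by (simp only: zword.simps zword_replicate comp_def)
  have p: "Lam.pth a b (Inl \<alpha> # replicate k (Inr a))"
    using \<alpha> path_replicate by (simp add: \<alpha>_def)
  have "parr (a + 1) (b + 1) g = parr (a + 1) (b + 1) (zword (Inl \<alpha> # replicate k (Inr a)))"
    using parr_eq_iff[OF g degree_map_zword[OF p]] z by fastforce
  then show ?thesis using p by metis
qed

section \<open>The epicyclic category\<close>

interpretation Lambda: category Lambda
  unfolding Lambda_def by (rule Lam.category_adj)

definition Lambda_PF :: "cyc_arr \<Rightarrow> zmax proj_arr" where
  "Lambda_PF = LF.ext"

lemma Obj_Lambda [simp]: "Obj Lambda = UNIV"
  by (simp add: Lambda_def)

lemma functor_Lambda_PF: "cat_functor Lambda PF (\<lambda>n. F_Fr (n + 1)) Lambda_PF"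
  unfolding Lambda_def Lambda_PF_def by (rule LF.functor_ext)

lemma Lambda_PF_cls: "Lam.pth a b w \<Longrightarrow> Lambda_PF (cyc_class a b w) = parr (a + 1) (b + 1) (zword w)"
  unfolding cyc_class_def Lambda_PF_def by (simp only: LF.ext_cls eval_zword)

lemma Src_cyc_class [simp]: "Src Lambda (cyc_class a b w) = a"
  and Tgt_cyc_class [simp]: "Tgt Lambda (cyc_class a b w) = b"
  unfolding Lambda_def cyc_class_def by simp_all

lemma Arr_LambdaE:
  assumes "f \<in> Arr Lambda" "Src Lambda f = a" "Tgt Lambda f = b"
  obtains w where "Lam.pth a b w" "f = cyc_class a b w"
proof -
  obtain a' b' w where w: "Lam.pth a' b' w" "f = cyc_class a' b' w"
    using assms(1) unfolding Lambda_def cyc_class_def by (rule Lam.Arr_adjE)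
  then have "a' = a" "b' = b" using assms(2,3) by simp_all
  with w that show ?thesis by simp
qed

lemma cyc_class_in: "Lam.pth a b w \<Longrightarrow> cyc_class a b w \<in> Arr Lambda"
  unfolding Lambda_def cyc_class_def by (rule Lam.cls_in)

lemma Cmp_cyc_class:
  "Lam.pth b c v \<Longrightarrow> Lam.pth a b w \<Longrightarrow> Cmp Lambda (cyc_class b c v) (cyc_class a b w) = cyc_class a c (v @ w)"
  unfolding Lambda_def cyc_class_def by (rule Lam.Cmp_cls)

lemma Lambda_PF_deg:
  assumes "f \<in> Arr Lambda"
  obtains g where "degree_map 1 (Src Lambda f + 1) (Tgt Lambda f + 1) g"
    "Lambda_PF f = parr (Src Lambda f + 1) (Tgt Lambda f + 1) g"
proof -
  obtain w where w: "Lam.pth (Src Lambda f) (Tgt Lambda f) w" "f = cyc_class (Src Lambda f) (Tgt Lambda f) w"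
    using assms HOL.refl HOL.refl by (rule Arr_LambdaE)
  have "Lambda_PF f = parr (Src Lambda f + 1) (Tgt Lambda f + 1) (zword w)"
    by (subst w(2)) (rule Lambda_PF_cls[OF w(1)])
  with degree_map_zword[OF w(1)] show ?thesis by (rule that)
qed

lemma Lambda_PF_inj:
  assumes f: "f \<in> Arr Lambda" and g: "g \<in> Arr Lambda"
    and ends: "Src Lambda f = Src Lambda g" "Tgt Lambda f = Tgt Lambda g"
    and eq: "Lambda_PF f = Lambda_PF g"
  shows "f = g"
proof -
  define a b where "a = Src Lambda g" and "b = Tgt Lambda g"
  obtain v where v: "Lam.pth a b v" "f = cyc_class a b v"
    using f ends[folded a_def b_def] by (rule Arr_LambdaE)
  obtain w where w: "Lam.pth a b w" "g = cyc_class a b w"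
    using g a_def[symmetric] b_def[symmetric] by (rule Arr_LambdaE)
  have "Lam.cong a b v w"
    using eq unfolding v(2) w(2) Lambda_PF_cls[OF v(1)] Lambda_PF_cls[OF w(1)]
    by (rule Lambda_faithful[OF v(1) w(1)])
  then show ?thesis unfolding v(2) w(2) cyc_class_def by (rule Lam.cls_eqI)
qed

lemma Lambda_PF_surj:
  assumes "degree_map 1 (a + 1) (b + 1) g"
  obtains f where "f \<in> Arr Lambda" "Src Lambda f = a" "Tgt Lambda f = b"
    "Lambda_PF f = parr (a + 1) (b + 1) g"
proof -
  obtain w where w: "Lam.pth a b w" "parr (a + 1) (b + 1) (zword w) = parr (a + 1) (b + 1) g"
    using Lambda_full[OF assms] by blast
  show ?thesis
    by (rule that[of "cyc_class a b w"]) (simp_all only: cyc_class_in w Src_cyc_class Tgt_cyc_class Lambda_PF_cls)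
qed

lemma Delta_to_Lambda:
  assumes "\<alpha> \<in> Arr Delta"
  shows "Delta_to_Lambda \<alpha> \<in> Arr Lambda" "Lambda_PF (Delta_to_Lambda \<alpha>) = simp_PF \<alpha>"
  using assms cyc_class_in[of "Src Delta \<alpha>" "Tgt Delta \<alpha>" "[Inl \<alpha>]"]
    Lambda_PF_cls[of "Src Delta \<alpha>" "Tgt Delta \<alpha>" "[Inl \<alpha>]"]
  by (simp_all add: Delta_to_Lambda_def simp_PF_def comp_def)

lemma Delta_to_Lambda_ends [simp]:
  "Src Lambda (Delta_to_Lambda \<alpha>) = Src Delta \<alpha>" "Tgt Lambda (Delta_to_Lambda \<alpha>) = Tgt Delta \<alpha>"
  by (simp_all add: Delta_to_Lambda_def)

lemma tau_in: "tau n \<in> Arr Lambda" and tau_ends [simp]: "Src Lambda (tau n) = n" "Tgt Lambda (tau n) = n"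
  and Lambda_PF_tau: "Lambda_PF (tau n) = tau_PF n"
  using cyc_class_in[of n n "[Inr n]"] Lambda_PF_cls[of n n "[Inr n]"]
  by (simp_all add: tau_def tau_PF_def comp_def)

section \<open>The epicyclic relations on integer maps\<close>

interpretation Epi: adjoining Lambda pi_gens pi_src pi_tgt Epicyclic_rels ..

definition pi_PF :: "nat \<times> nat \<Rightarrow> zmax proj_arr" where
  "pi_PF = (\<lambda>(n, k). parr (k * (n + 1)) (n + 1) (\<lambda>x. x))"

lemma degree_map_pi: "degree_map k (k * n) n (\<lambda>x. x)"
  by (simp add: degree_map_def mono_def)

lemma degree_map_scale: "degree_map 1 m n g \<Longrightarrow> degree_map 1 (k * m) (k * n) g"
  using degree_map_mult[of 1 m n g _ "int k"] by (simp add: degree_map_def algebra_simps)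

text \<open>The k-fold concatenation is the same integer map seen with periods k times as long. This
  is why the relation between \<open>Sd\<close> and \<pi>, with \<pi> realized by the identity,
  holds among projective classes.\<close>

lemma zlift_Sd:
  assumes "\<alpha> \<in> Arr Delta" "1 \<le> k"
  shows "zlift (Sd k \<alpha>) = zlift \<alpha>"
proof (rule zlift_eqI)
  obtain m f n where \<alpha>: "\<alpha> = (m, f, n)" by (cases \<alpha>)
  have k: "k * (m + 1) - 1 + 1 = k * (m + 1)" "k * (n + 1) - 1 + 1 = k * (n + 1)"
    using assms(2) by (simp_all del: mult_Suc_right)
  show "Sd k \<alpha> \<in> Arr Delta" using assms by (rule Sd_in)
  have "degree_map 1 (k * (m + 1)) (k * (n + 1)) (zlift \<alpha>)"
    using degree_map_scale[OF degree_map_zlift[OF assms(1)]] by (simp add: \<alpha>)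
  then show "degree_map 1 (Src Delta (Sd k \<alpha>) + 1) (Tgt Delta (Sd k \<alpha>) + 1) (zlift \<alpha>)"
    using k by (simp add: Sd_def \<alpha> del: mult_Suc_right)
  fix i assume "i \<le> Src Delta (Sd k \<alpha>)"
  then have "fst (snd (Sd k \<alpha>)) i = i div (m + 1) * (n + 1) + f (i mod (m + 1))"
    by (simp add: Sd_def \<alpha> del: mult_Suc_right)
  moreover have "int i div (int m + 1) = int (i div (m + 1))" "int i mod (int m + 1) = int (i mod (m + 1))"
    by (simp_all add: zdiv_int zmod_int add.commute)
  ultimately show "zlift \<alpha> (int i) = int (fst (snd (Sd k \<alpha>)) i)"
    by (simp add: \<alpha> zlift_def algebra_simps)
qed

lemma Sd_ends [simp]:
  "Src Delta (Sd k \<alpha>) = k * (Src Delta \<alpha> + 1) - 1" "Tgt Delta (Sd k \<alpha>) = k * (Tgt Delta \<alpha> + 1) - 1"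
  by (cases \<alpha>; simp add: Sd_def)+

lemma Epicyclic_rels_PF:
  assumes "(v, w) \<in> Epicyclic_rels" "Epi.pth a b v" "Epi.pth a b w"
  shows "eval_path PF (\<lambda>n. F_Fr (n + 1)) Lambda_PF pi_PF a v =
    eval_path PF (\<lambda>n. F_Fr (n + 1)) Lambda_PF pi_PF a w"
proof -
  \<comment> \<open>Objects [n] are numbered by \<open>n\<close> but carry period
    \<open>n + 1\<close>; for positive \<open>k\<close> the truncated subtraction in the source of
    \<pi> is exact.\<close>
  have k1: "k * (n + 1) - 1 + 1 = k * (n + 1)" if "1 \<le> k" for k n :: nat
    using that by (cases k) auto
  have pi_in: "pi_PF (n, k) \<in> Arr PF" "Src PF (pi_PF (n, k)) = F_Fr (k * (n + 1))" if "1 \<le> k" for n k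
    using that parr_in[OF degree_map_pi, of k "n + 1"] by (simp_all add: pi_PF_def)
  \<comment> \<open>The evaluation of a word ends in an identity, which has to be removed before
    \<open>Cmp_parr\<close> can be used.\<close>
  have right: "Cmp PF (pi_PF (n, k)) (Idn PF (F_Fr (k * (n + 1)))) = pi_PF (n, k)" if "1 \<le> k" for n k
    using PF.Cmp_Idn_right pi_in[OF that, of n] by metis
  consider (1) n where "v = [Inr (n, 1)]" "w = []"
    | (2) n k l where "v = [Inr (n, l), Inr (l * (n + 1) - 1, k)]" "w = [Inr (n, k * l)]" "1 \<le> k" "1 \<le> l"
    | (3) \<alpha> k where "v = [Inl (Delta_to_Lambda \<alpha>), Inr (Src Delta \<alpha>, k)]"
       "w = [Inr (Tgt Delta \<alpha>, k), Inl (Delta_to_Lambda (Sd k \<alpha>))]" "\<alpha> \<in> Arr Delta" "1 \<le> k"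
    | (4) n k where "v = [Inl (tau n), Inr (n, k)]" "w = [Inr (n, k), Inl (tau (k * (n + 1) - 1))]" "1 \<le> k"
    using assms(1) unfolding Epicyclic_rels_def by blast
  then show ?thesis
  proof cases
    case 1
    have "a = n" using assms(2) 1 by (simp add: pi_src_def)
    then show ?thesis using 1 right[of 1 n] by (simp add: pi_PF_def Idn_PF)
  next
    case 2
    have a: "a + 1 = k * (l * (n + 1))"
      using assms(2) 2 k1[of l n] k1[of k "l * (n + 1) - 1"] by (simp add: pi_src_def del: mult_Suc_right)
    have "Cmp PF (parr (l * (n + 1)) (n + 1) (\<lambda>x. x)) (parr (k * (l * (n + 1))) (l * (n + 1)) (\<lambda>x. x))
        = parr (k * (l * (n + 1))) (n + 1) ((\<lambda>x. x) \<circ> (\<lambda>x. x))"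
      by (rule Cmp_parr[OF degree_map_pi degree_map_pi]) (use 2 in auto)
    then have "Cmp PF (pi_PF (n, l)) (pi_PF (l * (n + 1) - 1, k)) = pi_PF (n, k * l)"
      unfolding pi_PF_def prod.case k1[OF 2(4)] by (simp only: comp_def mult.assoc)
    moreover have "1 \<le> k * l" using 2 by simp
    ultimately show ?thesis
      using 2 a right[of k "l * (n + 1) - 1"] right[of "k * l" n] k1[of l n]
      by (simp add: mult.assoc del: mult_Suc_right One_nat_def)
  next
    case 3
    obtain m n where mn: "Src Delta \<alpha> = m" "Tgt Delta \<alpha> = n" by blast
    have a: "a + 1 = k * (m + 1)"
      using assms(2) 3 mn k1[of k m] by (simp add: pi_src_def del: mult_Suc_right)
    have S: "Sd k \<alpha> \<in> Arr Delta" using 3 Sd_in by simp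
    have Sk: "simp_PF (Sd k \<alpha>) = parr (k * (m + 1)) (k * (n + 1)) (zlift \<alpha>)"
      unfolding simp_PF_def Sd_ends mn k1[OF 3(4)] zlift_Sd[OF 3(3,4)] ..
    have deg: "degree_map 1 (m + 1) (n + 1) (zlift \<alpha>)" "degree_map 1 (k * (m + 1)) (k * (n + 1)) (zlift \<alpha>)"
      using degree_map_zlift[OF 3(3)] degree_map_zlift[OF S] unfolding Sd_ends mn k1[OF 3(4)] zlift_Sd[OF 3(3,4)]
      by auto
    have "Cmp PF (simp_PF \<alpha>) (pi_PF (m, k)) = parr (k * (m + 1)) (n + 1) (zlift \<alpha> \<circ> (\<lambda>x. x))"
      unfolding simp_PF_def mn pi_PF_def prod.case
      by (rule Cmp_parr[OF degree_map_pi deg(1)]) (use 3 in auto)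
    moreover have "Cmp PF (pi_PF (n, k)) (simp_PF (Sd k \<alpha>)) = parr (k * (m + 1)) (n + 1) ((\<lambda>x. x) \<circ> zlift \<alpha>)"
      unfolding Sk pi_PF_def prod.case
      by (rule Cmp_parr[OF deg(2) degree_map_pi]) (use 3 in auto)
    moreover have "Cmp PF (simp_PF (Sd k \<alpha>)) (Idn PF (F_Fr (k * (m + 1)))) = simp_PF (Sd k \<alpha>)"
      using PF.Cmp_Idn_right[OF LF.Fa_in[OF S]] by (simp add: Sk)
    ultimately show ?thesis
      using 3 a right[of k m] S mn by (simp add: Delta_to_Lambda comp_def del: mult_Suc_right)
  next
    case 4
    have a: "a + 1 = k * (n + 1)"
      using assms(2) 4 k1[of k n] by (simp add: pi_src_def del: mult_Suc_right)
    have T: "tau_PF (k * (n + 1) - 1) = parr (k * (n + 1)) (k * (n + 1)) (\<lambda>x. x + (- 1))"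
      unfolding tau_PF_def k1[OF 4(3)] ..
    have "Cmp PF (tau_PF n) (pi_PF (n, k)) = parr (k * (n + 1)) (n + 1) ((\<lambda>x. x + (- 1)) \<circ> (\<lambda>x. x))"
      unfolding tau_PF_def pi_PF_def prod.case
      by (rule Cmp_parr[OF degree_map_pi degree_map_translate]) (use 4 in auto)
    moreover have "Cmp PF (pi_PF (n, k)) (tau_PF (k * (n + 1) - 1)) = parr (k * (n + 1)) (n + 1) ((\<lambda>x. x) \<circ> (\<lambda>x. x + (- 1)))"
      unfolding T pi_PF_def prod.case
      by (rule Cmp_parr[OF degree_map_translate degree_map_pi]) (use 4 in auto)
    moreover have "Cmp PF (tau_PF (k * (n + 1) - 1)) (Idn PF (F_Fr (k * (n + 1)))) = tau_PF (k * (n + 1) - 1)"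
      using PF.Cmp_Idn_right[OF LF.Fg_in[of "k * (n + 1) - 1"]] by (simp only: T Src_parr UNIV_I)
    ultimately show ?thesis
      using 4 a right[of k n] by (simp add: Lambda_PF_tau comp_def del: mult_Suc_right One_nat_def)
  qed
qed

section \<open>Normal forms of epicyclic words\<close>

lemma pi_gens_iff [simp]: "(n, k) \<in> pi_gens \<longleftrightarrow> 1 \<le> k"
  by (simp add: pi_gens_def)

lemma Delta_pi_rel:
  "\<lbrakk>\<alpha> \<in> Arr Delta; 1 \<le> k\<rbrakk> \<Longrightarrow> ([Inl (Delta_to_Lambda \<alpha>), Inr (Src Delta \<alpha>, k)],
    [Inr (Tgt Delta \<alpha>, k), Inl (Delta_to_Lambda (Sd k \<alpha>))]) \<in> Epicyclic_rels"
  unfolding Epicyclic_rels_def by blast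

lemma tau_pi_rel:
  "1 \<le> k \<Longrightarrow> ([Inl (tau n), Inr (n, k)], [Inr (n, k), Inl (tau (pi_src (n, k)))]) \<in> Epicyclic_rels"
  unfolding Epicyclic_rels_def pi_src_def prod.case by blast

lemma pi_pi_rel:
  "\<lbrakk>1 \<le> k; 1 \<le> l\<rbrakk> \<Longrightarrow> ([Inr (n, l), Inr (pi_src (n, l), k)], [Inr (n, k * l)]) \<in> Epicyclic_rels"
  unfolding Epicyclic_rels_def pi_src_def prod.case by blast

lemma pi_src_plus: "1 \<le> k \<Longrightarrow> pi_src (n, k) + 1 = k * (n + 1)"
  by (cases k) (auto simp: pi_src_def)

interpretation EF: adjoining_functor Lambda pi_gens pi_src pi_tgt Epicyclic_rels PF "\<lambda>n. F_Fr (n + 1)"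
  Lambda_PF pi_PF
proof -
  interpret cat_functor Lambda PF "\<lambda>n. F_Fr (n + 1)" Lambda_PF by (rule functor_Lambda_PF)
  show "adjoining_functor Lambda pi_gens pi_src pi_tgt Epicyclic_rels PF (\<lambda>n. F_Fr (n + 1)) Lambda_PF pi_PF"
  proof
    fix g assume "g \<in> pi_gens"
    then obtain n k where g: "g = (n, k)" "1 \<le> k" by (cases g) auto
    show "pi_PF g \<in> Arr PF" unfolding g pi_PF_def prod.case
      by (rule parr_in[OF degree_map_pi]) (use g in auto)
    show "Src PF (pi_PF g) = F_Fr (pi_src g + 1)"
      unfolding g pi_src_plus[OF g(2)] by (simp add: pi_PF_def)
    show "Tgt PF (pi_PF g) = F_Fr (pi_tgt g + 1)" by (simp add: g pi_PF_def pi_tgt_def)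
  qed (rule Epicyclic_rels_PF)
qed

text \<open>Moving \<pi> leftwards through a cyclic word replaces each letter by its k-fold lift.
  The integer map stays the same and only its periods are scaled; this record of the map is what
  later identifies the lift of a power of \<tau>.\<close>

lemma pi_src_cyc: "Lam.pth a b w \<Longrightarrow> 1 \<le> k \<Longrightarrow>
  \<exists>f. f \<in> Arr Lambda \<and> Src Lambda f = pi_src (a, k) \<and> Tgt Lambda f = pi_src (b, k) \<and>
    Lambda_PF f = parr (k * (a + 1)) (k * (b + 1)) (zword w) \<and>
    Epi.cong (pi_src (a, k)) b [Inl (cyc_class a b w), Inr (a, k)] [Inr (b, k), Inl f]"
proof (induction w arbitrary: b)
  case Nil
  then have b: "b = a" by simp
  have I: "cyc_class a a [] = Idn Lambda a" by (simp add: Lambda_def Lam.Idn_adj cyc_class_def)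
  let ?s = "pi_src (a, k)"
  have c1: "Epi.cong ?s a ([Inl (Idn Lambda a)] @ [Inr (a, k)]) ([] @ [Inr (a, k)])"
    by (rule Epi.cong_appendR[OF Epi.cong_Idn]) (use Nil in \<open>auto simp: pi_tgt_def\<close>)
  have c2: "Epi.cong ?s a ([Inr (a, k)] @ [Inl (Idn Lambda ?s)]) ([Inr (a, k)] @ [])"
    by (rule Epi.cong_appendL[OF _ Epi.cong_Idn]) (use Nil in \<open>auto simp: pi_tgt_def\<close>)
  have "Epi.cong ?s a [Inl (Idn Lambda a), Inr (a, k)] [Inr (a, k), Inl (Idn Lambda ?s)]"
    using Epi.cong_trans[OF c1[simplified] Epi.cong_sym[OF c2[simplified]]] .
  moreover have "Lambda_PF (Idn Lambda ?s) = parr (k * (a + 1)) (k * (a + 1)) (\<lambda>x. x)"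
    using cat_functor.Fa_Idn[OF functor_Lambda_PF, of ?s] unfolding pi_src_plus[OF Nil.prems(2)]
    by (simp add: Idn_PF)
  ultimately show ?case
    unfolding b I using Lambda.Idn_in[of ?s] Lambda.Src_Idn[of ?s] Lambda.Tgt_Idn[of ?s]
    by (intro exI[of _ "Idn Lambda ?s"]) simp
next
  case (Cons x w)
  \<comment> \<open>\<open>c\<close> is the object between the first letter and the rest of the
    word, \<open>g\<close> is the letter as a cyclic arrow, and \<open>h\<close> is its lift as
    prescribed by the defining relations.\<close>
  define c where "c = (case x of Inl \<alpha> \<Rightarrow> Src Delta \<alpha> | Inr n \<Rightarrow> n)"
  define g where "g = (case x of Inl \<alpha> \<Rightarrow> Delta_to_Lambda \<alpha> | Inr n \<Rightarrow> tau n)"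
  define h where "h = (case x of Inl \<alpha> \<Rightarrow> Delta_to_Lambda (Sd k \<alpha>) | Inr n \<Rightarrow> tau (pi_src (n, k)))"
  have w: "Lam.pth a c w" and x: "Lam.pth c b [x]"
    using Cons.prems(1) by (cases x; auto simp: c_def)+
  have g: "g = cyc_class c b [x]"
    using Cons.prems(1) by (cases x) (auto simp: g_def c_def Delta_to_Lambda_def tau_def)
  then have gA: "g \<in> Arr Lambda" "Src Lambda g = c" "Tgt Lambda g = b"
    using cyc_class_in[OF x] by auto
  have h: "h \<in> Arr Lambda" "Src Lambda h = pi_src (c, k)" "Tgt Lambda h = pi_src (b, k)"
    using Cons.prems by (cases x; auto simp: h_def c_def Sd_in Delta_to_Lambda tau_in pi_src_def)+
  obtain f where f: "f \<in> Arr Lambda" "Src Lambda f = pi_src (a, k)" "Tgt Lambda f = pi_src (c, k)"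
      "Epi.cong (pi_src (a, k)) c [Inl (cyc_class a c w), Inr (a, k)] [Inr (c, k), Inl f]"
      "Lambda_PF f = parr (k * (a + 1)) (k * (c + 1)) (zword w)"
    using Cons.IH[OF w Cons.prems(2)] by blast
  have hF: "Lambda_PF h = parr (k * (c + 1)) (k * (b + 1)) (zword [x])"
  proof (cases x)
    case (Inl \<alpha>)
    then have \<alpha>: "\<alpha> \<in> Arr Delta" "Src Delta \<alpha> = c" "Tgt Delta \<alpha> = b"
      using x by (auto simp: c_def)
    have "k * (c + 1) - 1 + 1 = k * (c + 1)" "k * (b + 1) - 1 + 1 = k * (b + 1)"
      using Cons.prems(2) by (simp_all del: mult_Suc_right)
    then show ?thesis
      using Delta_to_Lambda(2)[OF Sd_in[OF \<alpha>(1) Cons.prems(2)]] zlift_Sd[OF \<alpha>(1) Cons.prems(2)] \<alpha>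
      by (simp add: h_def Inl simp_PF_def comp_def del: mult_Suc_right)
  next
    case (Inr n)
    then show ?thesis using x pi_src_plus[OF Cons.prems(2), of n]
      by (simp add: h_def Lambda_PF_tau tau_PF_def comp_def c_def del: mult_Suc_right)
  qed
  have "Lambda_PF (Cmp Lambda h f) = Cmp PF (Lambda_PF h) (Lambda_PF f)"
    using cat_functor.Fa_Cmp[OF functor_Lambda_PF f(1) h(1)] f h by simp
  also have "\<dots> = parr (k * (a + 1)) (k * (b + 1)) (zword [x] \<circ> zword w)"
    unfolding f(5) hF
    by (rule Cmp_parr[OF degree_map_scale[OF degree_map_zword[OF w]] degree_map_scale[OF degree_map_zword[OF x]]])
      (use Cons.prems in auto)
  also have "zword [x] \<circ> zword w = zword (x # w)"
    using zword_append[of "[x]" w] by simp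
  finally have F: "Lambda_PF (Cmp Lambda h f) = parr (k * (a + 1)) (k * (b + 1)) (zword (x # w))" .
  let ?s = "pi_src (a, k)"
  have wA: "cyc_class a c w \<in> Arr Lambda" using cyc_class_in[OF w] .
  have eq: "cyc_class a b (x # w) = Cmp Lambda g (cyc_class a c w)"
    unfolding g using Cmp_cyc_class[OF x w] by simp
  have rel: "Epi.cong (pi_src (c, k)) b [Inl g, Inr (c, k)] [Inr (b, k), Inl h]"
  proof (rule Epi.cong_rel)
    show "([Inl g, Inr (c, k)], [Inr (b, k), Inl h]) \<in> Epicyclic_rels"
      using Cons.prems Delta_pi_rel tau_pi_rel by (cases x) (auto simp: g_def h_def c_def)
  qed (use gA h Cons.prems in \<open>auto simp: pi_tgt_def\<close>)
  \<comment> \<open>Split off the first letter, move \<pi> through the rest by induction, then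
    through the letter by its relation, and compose the two lifts.\<close>
  have "Epi.cong ?s b ([Inl (Cmp Lambda g (cyc_class a c w))] @ [Inr (a, k)]) ([Inl g, Inl (cyc_class a c w)] @ [Inr (a, k)])"
    by (rule Epi.cong_appendR[OF Epi.cong_sym[OF Epi.cong_Cmp]]) (use gA wA Cons.prems in \<open>auto simp: pi_tgt_def\<close>)
  also have "[Inl g, Inl (cyc_class a c w)] @ [Inr (a, k)] = [Inl g] @ [Inl (cyc_class a c w), Inr (a, k)]" by simp
  also have "Epi.cong ?s b ([Inl g] @ [Inl (cyc_class a c w), Inr (a, k)]) ([Inl g] @ [Inr (c, k), Inl f])"
    by (rule Epi.cong_appendL[OF _ f(4)]) (use gA in auto)
  also have "[Inl g] @ [Inr (c, k), Inl f] = [Inl g, Inr (c, k)] @ [Inl f]" by simp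
  also have "Epi.cong ?s b ([Inl g, Inr (c, k)] @ [Inl f]) ([Inr (b, k), Inl h] @ [Inl f])"
    by (rule Epi.cong_appendR[OF rel]) (use f in auto)
  also have "[Inr (b, k), Inl h] @ [Inl f] = [Inr (b, k)] @ [Inl h, Inl f]" by simp
  also have "Epi.cong ?s b ([Inr (b, k)] @ [Inl h, Inl f]) ([Inr (b, k)] @ [Inl (Cmp Lambda h f)])"
    by (rule Epi.cong_appendL[OF _ Epi.cong_Cmp]) (use f h Cons.prems in \<open>auto simp: pi_tgt_def\<close>)
  finally have "Epi.cong ?s b [Inl (cyc_class a b (x # w)), Inr (a, k)] [Inr (b, k), Inl (Cmp Lambda h f)]"
    by (simp add: eq)
  then show ?case
    using f h F Lambda.Cmp_in[OF f(1) h(1)] Lambda.Src_Cmp[OF f(1) h(1)] Lambda.Tgt_Cmp[OF f(1) h(1)]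
    by (intro exI[of _ "Cmp Lambda h f"]) simp
qed

lemma pi_exchange:
  assumes "f \<in> Arr Lambda" "1 \<le> k"
  obtains f' where "f' \<in> Arr Lambda" "Src Lambda f' = pi_src (Src Lambda f, k)"
    "Tgt Lambda f' = pi_src (Tgt Lambda f, k)"
    "Epi.cong (pi_src (Src Lambda f, k)) (Tgt Lambda f)
       [Inl f, Inr (Src Lambda f, k)] [Inr (Tgt Lambda f, k), Inl f']"
proof -
  obtain w where w: "Lam.pth (Src Lambda f) (Tgt Lambda f) w" "f = cyc_class (Src Lambda f) (Tgt Lambda f) w"
    using assms(1) HOL.refl HOL.refl by (rule Arr_LambdaE)
  show ?thesis using pi_src_cyc[OF w(1) assms(2)] that unfolding w(2)[symmetric] by blast
qed

text \<open>Induction from the right end of the word: a further cyclic letter is moved past the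
  collected \<pi> by \<open>pi_exchange\<close>, and a further \<pi> is merged with it, multiplying
  the indices.\<close>

lemma epi_normal:
  assumes "Epi.pth a b w"
  shows "\<exists>f k. 1 \<le> k \<and> f \<in> Arr Lambda \<and> Src Lambda f = a \<and> Tgt Lambda f = pi_src (b, k) \<and>
    Epi.cong a b w [Inr (b, k), Inl f]"
  using assms
proof (induction w arbitrary: b)
  case Nil
  then have b: "b = a" by simp
  have 1: "pi_src (a, 1) = a" by (simp add: pi_src_def)
  \<comment> \<open>The empty word gets the normal form with \<open>k = 1\<close> and an identity,
    using that the first \<pi> is trivial.\<close>
  have c1: "Epi.cong a a [Inr (a, 1)] []"
    by (rule Epi.cong_rel) (auto simp: Epicyclic_rels_def pi_tgt_def 1[simplified])
  have c2: "Epi.cong a a ([Inr (a, 1)] @ [Inl (Idn Lambda a)]) ([Inr (a, 1)] @ [])"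
    by (rule Epi.cong_appendL[OF _ Epi.cong_Idn]) (auto simp: pi_tgt_def 1[simplified])
  have "Epi.cong a a [] [Inr (a, 1), Inl (Idn Lambda a)]"
    using Epi.cong_sym[OF Epi.cong_trans[OF c2[unfolded append_Nil2] c1]] by simp
  then show ?case
    unfolding b using Lambda.Idn_in[of a] Lambda.Src_Idn[of a] Lambda.Tgt_Idn[of a] 1
    by (intro exI[of _ "Idn Lambda a"] exI[of _ 1]) simp
next
  case (Cons x w)
  show ?case
  proof (cases x)
    case (Inl g)
    then have g: "g \<in> Arr Lambda" "Tgt Lambda g = b" "Epi.pth a (Src Lambda g) w" using Cons.prems by auto
    define c where "c = Src Lambda g"
    obtain f k where f: "1 \<le> k" "f \<in> Arr Lambda" "Src Lambda f = a" "Tgt Lambda f = pi_src (c, k)"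
        "Epi.cong a c w [Inr (c, k), Inl f]"
      using Cons.IH[OF g(3)] by (auto simp: c_def)
    obtain g' where g': "g' \<in> Arr Lambda" "Src Lambda g' = pi_src (c, k)" "Tgt Lambda g' = pi_src (b, k)"
        "Epi.cong (pi_src (c, k)) b [Inl g, Inr (c, k)] [Inr (b, k), Inl g']"
      using pi_exchange[OF g(1) f(1)] unfolding g(2) c_def by blast
    have "Epi.cong a b ([Inl g] @ w) ([Inl g] @ [Inr (c, k), Inl f])"
      by (rule Epi.cong_appendL[OF _ f(5)]) (use g in \<open>auto simp: c_def\<close>)
    also have "[Inl g] @ [Inr (c, k), Inl f] = [Inl g, Inr (c, k)] @ [Inl f]" by simp
    also have "Epi.cong a b ([Inl g, Inr (c, k)] @ [Inl f]) ([Inr (b, k), Inl g'] @ [Inl f])"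
      by (rule Epi.cong_appendR[OF g'(4)]) (use f in auto)
    also have "[Inr (b, k), Inl g'] @ [Inl f] = [Inr (b, k)] @ [Inl g', Inl f]" by simp
    also have "Epi.cong a b ([Inr (b, k)] @ [Inl g', Inl f]) ([Inr (b, k)] @ [Inl (Cmp Lambda g' f)])"
      by (rule Epi.cong_appendL[OF _ Epi.cong_Cmp]) (use f g' in \<open>auto simp: pi_tgt_def\<close>)
    finally have "Epi.cong a b (x # w) [Inr (b, k), Inl (Cmp Lambda g' f)]" using Inl by simp
    moreover have "Cmp Lambda g' f \<in> Arr Lambda" "Src Lambda (Cmp Lambda g' f) = a"
        "Tgt Lambda (Cmp Lambda g' f) = pi_src (b, k)"
      using f g' by (simp_all add: Lambda.Cmp_in Lambda.Src_Cmp Lambda.Tgt_Cmp)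
    ultimately show ?thesis using f(1) by blast
  next
    case (Inr p)
    then obtain l where p: "x = Inr (b, l)" "1 \<le> l" "Epi.pth a (pi_src (b, l)) w"
      using Cons.prems by (cases p) (auto simp: pi_tgt_def)
    define c where "c = pi_src (b, l)"
    obtain f k where f: "1 \<le> k" "f \<in> Arr Lambda" "Src Lambda f = a" "Tgt Lambda f = pi_src (c, k)"
        "Epi.cong a c w [Inr (c, k), Inl f]"
      using Cons.IH[OF p(3)] by (auto simp: c_def)
    have "1 \<le> k * l" using p(2) f(1) by simp
    \<comment> \<open>Comparing successors avoids the truncated subtraction in
      \<open>pi_src\<close>.\<close>
    have "pi_src (c, k) + 1 = pi_src (b, k * l) + 1"
      unfolding c_def pi_src_plus[OF f(1)] pi_src_plus[OF p(2)] pi_src_plus[OF \<open>1 \<le> k * l\<close>]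
      by (rule mult.assoc[symmetric])
    then have src: "pi_src (c, k) = pi_src (b, k * l)" by simp
    have "Epi.cong a b ([Inr (b, l)] @ w) ([Inr (b, l)] @ [Inr (c, k), Inl f])"
      by (rule Epi.cong_appendL[OF _ f(5)]) (use p in \<open>auto simp: c_def pi_tgt_def\<close>)
    also have "[Inr (b, l)] @ [Inr (c, k), Inl f] = [Inr (b, l), Inr (c, k)] @ [Inl f]" by simp
    also have "Epi.cong a b ([Inr (b, l), Inr (c, k)] @ [Inl f]) ([Inr (b, k * l)] @ [Inl f])"
    proof (rule Epi.cong_appendR[OF Epi.cong_rel])
      show "([Inr (b, l), Inr (c, k)], [Inr (b, k * l)]) \<in> Epicyclic_rels"
        using pi_pi_rel[OF f(1) p(2)] by (simp add: c_def)
      show "Epi.pth (pi_src (c, k)) b [Inr (b, l), Inr (c, k)]"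
        using p f by (auto simp: pi_tgt_def c_def)
      show "Epi.pth (pi_src (c, k)) b [Inr (b, k * l)]"
        using p f src by (auto simp: pi_tgt_def)
    qed (use f in auto)
    finally have "Epi.cong a b (x # w) [Inr (b, k * l), Inl f]" using p(1) by simp
    then show ?thesis using f src \<open>1 \<le> k * l\<close>
      by (intro exI[of _ f] exI[of _ "k * l"]) simp
  qed
qed

section \<open>Faithfulness and fullness for the epicyclic category\<close>

lemma EF_ev:
  assumes "1 \<le> k" "f \<in> Arr Lambda" "Src Lambda f = a" "Tgt Lambda f = pi_src (b, k)"
    and "degree_map 1 (a + 1) (k * (b + 1)) g" "Lambda_PF f = parr (a + 1) (k * (b + 1)) g"
  shows "Epi.pth a b [Inr (b, k), Inl f]" "EF.ev a [Inr (b, k), Inl f] = parr (a + 1) (b + 1) g"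
    "degree_map k (a + 1) (b + 1) g"
proof -
  show "Epi.pth a b [Inr (b, k), Inl f]" using assms by (simp add: pi_tgt_def)
  \<comment> \<open>Since \<pi> is realized by the identity, the integer map \<open>g\<close> is
    unchanged: a degree-one map into the semimodule of period \<open>k * (b + 1)\<close> is merely
    read with degree \<open>k\<close> into the one of period \<open>b + 1\<close>.\<close>
  have "Cmp PF (pi_PF (b, k)) (Lambda_PF f) = parr (a + 1) (b + 1) ((\<lambda>x. x) \<circ> g)"
    unfolding assms(6) pi_PF_def prod.case
    by (rule Cmp_parr[OF assms(5) degree_map_pi]) (use assms in auto)
  moreover have "Cmp PF (Lambda_PF f) (Idn PF (F_Fr (a + 1))) = Lambda_PF f"
    using PF.Cmp_Idn_right[of "Lambda_PF f"] EF.Fa_in[OF assms(2)] assms(6) by simp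
  ultimately show "EF.ev a [Inr (b, k), Inl f] = parr (a + 1) (b + 1) g"
    by (simp add: comp_def)
  show "degree_map k (a + 1) (b + 1) g" using assms(5) by (simp add: degree_map_def algebra_simps)
qed

text \<open>
  Translation by \<open>n + 1\<close> is trivial on \<open>[n]\<close>, hence becomes trivial on \<open>[k(n + 1) - 1]\<close> after
  composing with \<open>\<pi>\<^sub>n\<^sup>k\<close>, although it is not trivial there in the cyclic category.
\<close>

lemma pi_absorbs_translation:
  assumes "1 \<le> k"
  obtains t where "t \<in> Arr Lambda" "Src Lambda t = pi_src (b, k)" "Tgt Lambda t = pi_src (b, k)"
    "Lambda_PF t = parr (k * (b + 1)) (k * (b + 1)) (\<lambda>x. x + - int ((b + 1) * i))"
    "Epi.cong (pi_src (b, k)) b [Inr (b, k)] [Inr (b, k), Inl t]"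
proof -
  let ?s = "pi_src (b, k)" and ?w = "replicate ((b + 1) * i) (Inr b) :: (simp_arr + nat) list"
  obtain t where t: "t \<in> Arr Lambda" "Src Lambda t = ?s" "Tgt Lambda t = ?s"
      "Lambda_PF t = parr (k * (b + 1)) (k * (b + 1)) (zword ?w)"
      "Epi.cong ?s b [Inl (cyc_class b b ?w), Inr (b, k)] [Inr (b, k), Inl t]"
    using pi_src_cyc[OF path_replicate assms] by blast
  \<comment> \<open>The exponent is a multiple of the order of \<tau>, so the exchange through \<pi>
    starts from an identity although the lift \<open>t\<close> need not be one.\<close>
  have I: "cyc_class b b ?w = Idn Lambda b"
    using Lam.cls_eqI[OF tau_power_cong[of b 0 i]] by (simp add: Lambda_def Lam.Idn_adj cyc_class_def)
  have c: "Epi.cong ?s b ([Inl (Idn Lambda b)] @ [Inr (b, k)]) ([] @ [Inr (b, k)])"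
    by (rule Epi.cong_appendR[OF Epi.cong_Idn]) (use assms in \<open>auto simp: pi_tgt_def\<close>)
  have "Epi.cong ?s b [Inr (b, k)] [Inr (b, k), Inl t]"
    using Epi.cong_trans[OF Epi.cong_sym[OF c[unfolded append_Cons append_Nil]] t(5)[unfolded I]] .
  with t(1-3) t(4)[unfolded zword_replicate diff_conv_add_uminus] show ?thesis by (rule that)
qed

text \<open>In normal form, equal values force equal degrees and integer maps differing by a
  multiple of \<open>b + 1\<close>. Such a translation can be nontrivial in the cyclic category,
  where only multiples of \<open>k * (b + 1)\<close> vanish, but \<pi> absorbs it; faithfulness of
  the cyclic part then finishes the argument.\<close>

lemma Epicyclic_faithful:
  assumes v: "Epi.pth a b v" and w: "Epi.pth a b w" and eq: "EF.ev a v = EF.ev a w"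
  shows "Epi.cong a b v w"
proof -
  obtain f k where f: "1 \<le> k" "f \<in> Arr Lambda" "Src Lambda f = a" "Tgt Lambda f = pi_src (b, k)"
      "Epi.cong a b v [Inr (b, k), Inl f]"
    using epi_normal[OF v] by blast
  obtain f' l where f': "1 \<le> l" "f' \<in> Arr Lambda" "Src Lambda f' = a" "Tgt Lambda f' = pi_src (b, l)"
      "Epi.cong a b w [Inr (b, l), Inl f']"
    using epi_normal[OF w] by blast
  obtain g where g: "degree_map 1 (a + 1) (k * (b + 1)) g" "Lambda_PF f = parr (a + 1) (k * (b + 1)) g"
    using Lambda_PF_deg[OF f(2)] unfolding f(3,4) pi_src_plus[OF f(1)] .
  obtain g' where g': "degree_map 1 (a + 1) (l * (b + 1)) g'" "Lambda_PF f' = parr (a + 1) (l * (b + 1)) g'"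
    using Lambda_PF_deg[OF f'(2)] unfolding f'(3,4) pi_src_plus[OF f'(1)] .
  note G = EF_ev[OF f(1-4) g] and G' = EF_ev[OF f'(1-4) g']
  have "parr (a + 1) (b + 1) g = parr (a + 1) (b + 1) g'"
    using eq EF.ev_cong[OF f(5)] EF.ev_cong[OF f'(5)] G(2) G'(2) by metis
  then obtain c where c: "g' = (\<lambda>x. g x + int (b + 1) * c)"
    using parr_eq_iff[OF G(3) G'(3)] f(1) f'(1) by auto
  \<comment> \<open>A translate has the same degree as the original map, and the degree is
    unique.\<close>
  have kl: "k = l"
    using degree_map_unique[OF degree_map_add[OF G(3)]] G'(3) unfolding c by simp
  \<comment> \<open>Absorbed translations are downward by natural multiples of \<open>b + 1\<close>.
    The number \<open>i\<close> is congruent to \<open>- c\<close> modulo \<open>k\<close> and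
    nonnegative, and the excess \<open>k * \<bar>c\<bar>\<close> is invisible at period
    \<open>k * (b + 1)\<close>.\<close>
  define i where "i = nat (int k * \<bar>c\<bar> - c)"
  have "\<bar>c\<bar> \<le> int k * \<bar>c\<bar>" using f(1) by (simp add: mult_le_cancel_right1)
  then have "c \<le> int k * \<bar>c\<bar>" using abs_ge_self[of c] by linarith
  then have i: "int i = int k * \<bar>c\<bar> - c" by (simp add: i_def)
  let ?s = "pi_src (b, k)"
  obtain t where t: "t \<in> Arr Lambda" "Src Lambda t = ?s" "Tgt Lambda t = ?s"
      "Lambda_PF t = parr (k * (b + 1)) (k * (b + 1)) (\<lambda>x. x + - int ((b + 1) * i))"
      "Epi.cong ?s b [Inr (b, k)] [Inr (b, k), Inl t]"
    using pi_absorbs_translation[OF f(1)] by blast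
  define h where "h = (\<lambda>x. x + - int ((b + 1) * i)) \<circ> g"
  have "degree_map (1 * 1) (a + 1) (k * (b + 1)) h"
    unfolding h_def by (rule degree_map_comp[OF g(1) degree_map_translate])
  then have h: "degree_map 1 (a + 1) (k * (b + 1)) h" by simp
  have "Lambda_PF (Cmp Lambda t f) = Cmp PF (Lambda_PF t) (Lambda_PF f)"
    using cat_functor.Fa_Cmp[OF functor_Lambda_PF f(2) t(1)] f t by simp
  also have "\<dots> = parr (a + 1) (k * (b + 1)) h"
    unfolding g(2) t(4) h_def by (rule Cmp_parr[OF g(1) degree_map_translate]) (use f in auto)
  also have "\<dots> = parr (a + 1) (k * (b + 1)) g'"
  proof -
    have "g' x = h x + int (k * (b + 1)) * \<bar>c\<bar>" for x
      by (simp add: c h_def i algebra_simps)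
    then show ?thesis
      using parr_eq_iff[OF h g'(1)[folded kl]] f(1) by (auto simp: fun_eq_iff)
  qed
  finally have "Lambda_PF (Cmp Lambda t f) = Lambda_PF f'" using g'(2) kl by simp
  moreover have tf: "Cmp Lambda t f \<in> Arr Lambda" "Src Lambda (Cmp Lambda t f) = a" "Tgt Lambda (Cmp Lambda t f) = ?s"
    using f t by (simp_all add: Lambda.Cmp_in Lambda.Src_Cmp Lambda.Tgt_Cmp)
  ultimately have eq': "Cmp Lambda t f = f'"
    using Lambda_PF_inj f' kl by simp
  have "Epi.cong a b ([Inr (b, k)] @ [Inl f]) ([Inr (b, k), Inl t] @ [Inl f])"
    by (rule Epi.cong_appendR[OF t(5)]) (use f in auto)
  also have "[Inr (b, k), Inl t] @ [Inl f] = [Inr (b, k)] @ [Inl t, Inl f]" by simp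
  also have "Epi.cong a b ([Inr (b, k)] @ [Inl t, Inl f]) ([Inr (b, k)] @ [Inl (Cmp Lambda t f)])"
    by (rule Epi.cong_appendL[OF _ Epi.cong_Cmp]) (use f t in \<open>auto simp: pi_tgt_def\<close>)
  finally have "Epi.cong a b [Inr (b, k), Inl f] [Inr (b, l), Inl f']"
    by (simp add: eq' kl)
  then show ?thesis using f(5) f'(5) Epi.cong_trans Epi.cong_sym by blast
qed

lemma Epicyclic_full:
  assumes "degree_map k (a + 1) (b + 1) g" "1 \<le> k"
  shows "\<exists>w. Epi.pth a b w \<and> EF.ev a w = parr (a + 1) (b + 1) g"
proof -
  \<comment> \<open>The same map, read with degree one into the longer period, is covered by
    fullness for the cyclic category.\<close>
  have d: "degree_map 1 (a + 1) (k * (b + 1)) g"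
    using assms(1) by (simp add: degree_map_def algebra_simps)
  obtain f where f: "f \<in> Arr Lambda" "Src Lambda f = a" "Tgt Lambda f = pi_src (b, k)"
      "Lambda_PF f = parr (a + 1) (k * (b + 1)) g"
    using Lambda_PF_surj[of a "pi_src (b, k)" g] d unfolding pi_src_plus[OF assms(2)] by blast
  show ?thesis using EF_ev(1,2)[OF assms(2) f(1-3) d f(4)] by blast
qed

section \<open>The two isomorphisms of categories\<close>

lemma bij_objects: "bij_betw (\<lambda>n. F_Fr (n + 1)) UNIV (Obj PF)"
proof (rule bij_betwI')
  show "\<exists>n\<in>UNIV. E = F_Fr (n + 1)" if E: "E \<in> Obj PF" for E
  proof -
    obtain n where "E = F_Fr n" "1 \<le> n" using E unfolding Obj_PF by blast
    then show ?thesis by (intro bexI[of _ "n - 1"]) auto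
  qed
qed (auto simp: Obj_PF)

lemma Epicyclic_iso: "cat_iso Epicyclic PF (\<lambda>n. F_Fr (n + 1)) EF.ext"
  unfolding cat_iso_def
proof (intro conjI)
  show F: "cat_functor Epicyclic PF (\<lambda>n. F_Fr (n + 1)) EF.ext"
    unfolding Epicyclic_def by (rule EF.functor_ext)
  show "bij_betw (\<lambda>n. F_Fr (n + 1)) (Obj Epicyclic) (Obj PF)"
    using bij_objects by (simp add: Epicyclic_def)
  show "bij_betw EF.ext (Arr Epicyclic) (Arr PF)"
  proof (rule bij_betwI')
    fix f g assume fg: "f \<in> Arr Epicyclic" "g \<in> Arr Epicyclic"
    show "EF.ext f = EF.ext g \<longleftrightarrow> f = g"
    proof
      assume eq: "EF.ext f = EF.ext g"
      obtain a b v where v: "Epi.pth a b v" "f = Epi.cls a b v"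
        using fg(1) unfolding Epicyclic_def by (rule Epi.Arr_adjE)
      obtain a' b' w where w: "Epi.pth a' b' w" "g = Epi.cls a' b' w"
        using fg(2) unfolding Epicyclic_def by (rule Epi.Arr_adjE)
      have ev: "EF.ev a v = EF.ev a' w"
        using eq unfolding v(2) w(2) EF.ext_cls[OF v(1)] EF.ext_cls[OF w(1)] .
      \<comment> \<open>Faithfulness concerns parallel words only. Equal images have equal ends, and
        distinct periods give distinct semimodules.\<close>
      have "F_Fr (a + 1) = F_Fr (a' + 1)" "F_Fr (b + 1) = F_Fr (b' + 1)"
        using EF.ev_in[OF v(1)] EF.ev_in[OF w(1)] unfolding ev by simp_all
      then have "a' = a" "b' = b" by auto
      then have "Epi.cong a b v w"
        using Epicyclic_faithful[OF v(1)] w(1) ev by simp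
      then show "f = g" unfolding v(2) w(2) \<open>a' = a\<close> \<open>b' = b\<close> by (rule Epi.cls_eqI)
    qed simp
  next
    show "EF.ext f \<in> Arr PF" if "f \<in> Arr Epicyclic" for f
      using cat_functor.Fa_in[OF F that] .
    fix h assume "h \<in> Arr PF"
    then obtain k m n g where h: "1 \<le> k" "1 \<le> m" "1 \<le> n" "degree_map k m n g" "h = parr m n g"
      by (rule Arr_PFE)
    \<comment> \<open>The semimodule of period \<open>m\<close> is the image of [m - 1]; positivity
      of \<open>m\<close> and \<open>n\<close> makes the subtraction exact.\<close>
    then have "degree_map k (m - 1 + 1) (n - 1 + 1) g" by simp
    from Epicyclic_full[OF this h(1)]
    obtain w where w: "Epi.pth (m - 1) (n - 1) w" "EF.ev (m - 1) w = h" using h by auto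
    show "\<exists>f\<in>Arr Epicyclic. h = EF.ext f"
      unfolding Epicyclic_def
      by (rule bexI[OF _ Epi.cls_in[OF w(1)]]) (simp only: EF.ext_cls[OF w(1)] w(2))
  qed
qed

lemma EF_Lambda: "f \<in> Arr Lambda \<Longrightarrow> (EF.ext \<circ> Lambda_to_Epicyclic) f = Lambda_PF f"
  unfolding Lambda_to_Epicyclic_def epi_class_def comp_apply by (rule EF.ext_Inl)

text \<open>By \<open>EF_Lambda\<close> the composite is \<open>Lambda_PF\<close>, whose bijectivity
  onto the linear classes comes from the normal forms. In particular the functor from the cyclic to
  the epicyclic category is injective on arrows, so the former is indeed a subcategory.\<close>

lemma Lambda_iso: "cat_iso Lambda PF1 (\<lambda>n. F_Fr (n + 1)) (EF.ext \<circ> Lambda_to_Epicyclic)"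
proof -
  interpret PF1: category PF1 by (rule category_PF1)
  have in1: "Lambda_PF f \<in> Arr PF1" if f: "f \<in> Arr Lambda" for f
  proof -
    obtain g where "degree_map 1 (Src Lambda f + 1) (Tgt Lambda f + 1) g"
      "Lambda_PF f = parr (Src Lambda f + 1) (Tgt Lambda f + 1) g"
      using f by (rule Lambda_PF_deg)
    then show ?thesis using parr_in_PF1 by simp
  qed
  show ?thesis
    unfolding cat_iso_def
  proof (intro conjI)
    show "cat_functor Lambda PF1 (\<lambda>n. F_Fr (n + 1)) (EF.ext \<circ> Lambda_to_Epicyclic)"
    proof
      show "F_Fr (n + 1) \<in> Obj PF1" if "n \<in> Obj Lambda" for n
        using EF.Fo_in[OF that] by simp
      show "(EF.ext \<circ> Lambda_to_Epicyclic) f \<in> Arr PF1"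
        and "Src PF1 ((EF.ext \<circ> Lambda_to_Epicyclic) f) = F_Fr (Src Lambda f + 1)"
        and "Tgt PF1 ((EF.ext \<circ> Lambda_to_Epicyclic) f) = F_Fr (Tgt Lambda f + 1)"
        if "f \<in> Arr Lambda" for f
        unfolding EF_Lambda[OF that] PF1_sel
        using in1[OF that] EF.Src_Fa[OF that] EF.Tgt_Fa[OF that] by simp_all
      show "(EF.ext \<circ> Lambda_to_Epicyclic) (Idn Lambda n) = Idn PF1 (F_Fr (n + 1))"
        if "n \<in> Obj Lambda" for n
        unfolding EF_Lambda[OF Lambda.Idn_in[OF that]] PF1_sel by (rule EF.Fa_Idn[OF that])
      show "(EF.ext \<circ> Lambda_to_Epicyclic) (Cmp Lambda g f) =
          Cmp PF1 ((EF.ext \<circ> Lambda_to_Epicyclic) g) ((EF.ext \<circ> Lambda_to_Epicyclic) f)"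
        if "f \<in> Arr Lambda" "g \<in> Arr Lambda" "Tgt Lambda f = Src Lambda g" for f g
        unfolding EF_Lambda[OF that(1)] EF_Lambda[OF that(2)] EF_Lambda[OF Lambda.Cmp_in[OF that]] PF1_sel
        by (rule EF.Fa_Cmp[OF that])
    qed
    show "bij_betw (\<lambda>n. F_Fr (n + 1)) (Obj Lambda) (Obj PF1)"
      using bij_objects by simp
    have "bij_betw Lambda_PF (Arr Lambda) (Arr PF1)"
    proof (rule bij_betwI')
      fix f g assume fg: "f \<in> Arr Lambda" "g \<in> Arr Lambda"
      show "Lambda_PF f = Lambda_PF g \<longleftrightarrow> f = g"
      proof
        assume eq: "Lambda_PF f = Lambda_PF g"
        have "F_Fr (Src Lambda f + 1) = F_Fr (Src Lambda g + 1)" "F_Fr (Tgt Lambda f + 1) = F_Fr (Tgt Lambda g + 1)"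
          unfolding EF.Src_Fa[OF fg(1), symmetric] EF.Src_Fa[OF fg(2), symmetric]
            EF.Tgt_Fa[OF fg(1), symmetric] EF.Tgt_Fa[OF fg(2), symmetric] eq by (rule HOL.refl)+
        then show "f = g" using Lambda_PF_inj[OF fg] eq by simp
      qed simp
    next
      fix h assume "h \<in> Arr PF1"
      then obtain m n g where h: "1 \<le> m" "1 \<le> n" "degree_map 1 m n g" "h = parr m n g"
        by (rule Arr_PF1E)
      then have "degree_map 1 (m - 1 + 1) (n - 1 + 1) g" by simp
      then obtain f where "f \<in> Arr Lambda" "Lambda_PF f = parr (m - 1 + 1) (n - 1 + 1) g"
        by (rule Lambda_PF_surj)
      then show "\<exists>f\<in>Arr Lambda. h = Lambda_PF f" using h by (intro bexI[of _ f]) simp_all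
    qed (rule in1)
    then show "bij_betw (EF.ext \<circ> Lambda_to_Epicyclic) (Arr Lambda) (Arr PF1)"
      by (rule bij_betw_cong[THEN iffD1, rotated]) (rule EF_Lambda[symmetric])
  qed
qed

lemma canonical_EF: "canonical_on_generators EF.ext"
  unfolding canonical_on_generators_def
proof (intro conjI ballI allI impI)
  fix \<alpha> assume \<alpha>: "\<alpha> \<in> Arr Delta"
  show "EF.ext (Lambda_to_Epicyclic (Delta_to_Lambda \<alpha>)) =
      proj_class (F_Fr (Src Delta \<alpha> + 1)) (F_Fr (Tgt Delta \<alpha> + 1)) (simp_map \<alpha>)"
    using EF_Lambda[OF Delta_to_Lambda(1)[OF \<alpha>]] Delta_to_Lambda(2)[OF \<alpha>]
    by (simp add: simp_PF_def parr_def simp_map_zlift)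
next
  fix n
  show "EF.ext (Lambda_to_Epicyclic (tau n)) =
      proj_class (F_Fr (n + 1)) (F_Fr (n + 1)) (\<lambda>x. U (- 1) * x)"
    using EF_Lambda[OF tau_in] unfolding zext_translate by (simp add: Lambda_PF_tau tau_PF_def parr_def)
next
  fix n k :: nat assume k: "1 \<le> k"
  have "EF.ext (Epi.cls (pi_src (n, k)) (pi_tgt (n, k)) [Inr (n, k)]) = pi_PF (n, k)"
    by (rule EF.ext_Inr) (use k in auto)
  then show "EF.ext (epi_pi n k) = proj_class (F_Fr (k * (n + 1))) (F_Fr (n + 1)) id"
    unfolding epi_pi_def epi_class_def
    by (simp add: pi_src_def pi_tgt_def pi_PF_def parr_def zext_id)
qed

theorem theorem3p15:
  "\<exists>\<Phi>. canonical_on_generators \<Phi> \<and>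
     cat_iso Epicyclic PF (\<lambda>n. F_Fr (n + 1)) \<Phi> \<and>
     cat_iso Lambda PF1 (\<lambda>n. F_Fr (n + 1)) (\<Phi> \<circ> Lambda_to_Epicyclic)"
  using canonical_EF Epicyclic_iso Lambda_iso by blast

end
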